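(* Let $E \in C^3(\mathbb{R}^d)$ and $x^* \in \mathbb{R}^d$, and assume that the Hessian matrix $H^* = \nabla^2 E(x^* )$ is nondegenerate (has no zero eigenvalue), with eigenvalues $\lambda_1^* < \dots < \lambda_k^* < \lambda_{k+1}^* \leqslant \dots \leqslant \lambda_d^*$. Suppose that $v_1^*,\dots,v_k^* \in \mathbb{R}^d$ satisfy $\|v_i^*\|_2 = 1$ for $1\leqslant i\leqslant k$, and that $\beta, \gamma, \eta > 0$ are constants. Then $(x^*, v_1^*, \dots, v_k^* )$ is a linearly stable equilibrium point of the dynamical system $$ \left\{ \begin{aligned} \frac{\mathrm{d}x}{\mathrm{d}t} &= -\beta \left(I - \sum_{i=1}^{k} \left(1+\frac{\eta}{|\alpha_i|}\right)v_i v_i^{\top} \right) \nabla E(x),\\ \frac{\mathrm{d}v_i}{\mathrm{d}t} &= -\gamma \left( I - v_i v_i^{\top} - \sum_{j=1}^{i-1} 2v_j v_j^{\top} \right) \nabla^2E(x)v_i,\quad 1\leqslant i\leqslant k, \end{aligned} \right. \qquad \alpha_i = v_i^\top \nabla^2 E(x) v_i, $$ in the variables $(x,v_1,\dots,v_k)\in(\mathbb{R}^d)^{k+1}$, if and only if $x^*$ is an index-$k$ saddle point of $E$ and, for each $1\leqslant i\leqslant k$, $v_i^*$ is an eigenvector of $H^*$ corresponding to the eigenvalue $\lambda_i^*$.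
   Context: A point $x^*$ is an index-$k$ saddle point of $E$ if $\nabla E(x^* )=0$ and $\nabla^2E(x^* )$ has exactly $k$ negative eigenvalues. The right-hand side of the system is defined at points where $\alpha_i = v_i^\top\nabla^2E(x)v_i \neq 0$ for all $1\leqslant i\leqslant k$; an equilibrium point is a point of this domain at which the right-hand side vanishes. An equilibrium point is linearly stable if all eigenvalues of the Jacobian matrix of the right-hand side (with respect to $(x,v_1,\dots,v_k)$) at that point have negative real part. $\|\cdot\|_2$ is the Euclidean norm. *)

theory Defs
  imports "HOL-Analysis.Analysis" "HOL-Computational_Algebra.Polynomial"
begin

text \<open>Continuous differentiability of order \<open>m\<close> on the whole space. In finite dimension,
  continuity of all iterated directional derivatives is continuity of the iterated
  Frechet derivative up to order \<open>m\<close>.\<close>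

fun C_diff :: "nat \<Rightarrow> ('a::euclidean_space \<Rightarrow> real) \<Rightarrow> bool" where
  "C_diff 0 f \<longleftrightarrow> continuous_on UNIV f"
| "C_diff (Suc m) f \<longleftrightarrow>
     (\<forall>x. f differentiable (at x)) \<and> (\<forall>h. C_diff m (\<lambda>x. frechet_derivative f (at x) h))"

definition gradient :: "(real^'n \<Rightarrow> real) \<Rightarrow> real^'n \<Rightarrow> real^'n" where
  "gradient E x = (\<chi> i. frechet_derivative E (at x) (axis i 1))"

definition hessian :: "(real^'n \<Rightarrow> real) \<Rightarrow> real^'n \<Rightarrow> real^'n^'n" where
  "hessian E x = jacobian (gradient E) (at x)"

definition charpoly :: "'a::comm_ring_1^'n^'n \<Rightarrow> 'a poly" where
  "charpoly A = det (mat [:0, 1:] - map_matrix (\<lambda>a. [:a:]) A)"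

text \<open>The eigenvalues in the scalar field \<open>'a\<close>, with algebraic multiplicity. It is used
  below only for Hessians of \<open>C\<^sup>2\<close> functions, which are symmetric, so over the reals no
  eigenvalue is lost.\<close>

definition eigenvalues :: "'a::idom^'n^'n \<Rightarrow> 'a multiset" where
  "eigenvalues A = proots (charpoly A)"

definition eigenvector :: "real^'n^'n \<Rightarrow> real^'n \<Rightarrow> real \<Rightarrow> bool" where
  "eigenvector A v \<mu> \<longleftrightarrow> v \<noteq> 0 \<and> A *v v = \<mu> *\<^sub>R v"

definition index_saddle :: "nat \<Rightarrow> (real^'n \<Rightarrow> real) \<Rightarrow> real^'n \<Rightarrow> bool" where
  "index_saddle k E x \<longleftrightarrow>
     gradient E x = 0 \<and> size {#\<mu> \<in># eigenvalues (hessian E x). \<mu> < 0#} = k"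

text \<open>Complex eigenvalues of the Jacobian matrix of a vector field \<open>F\<close> on a Euclidean space:
  the matrix has the entries \<open>frechet_derivative F (at s) c \<bullet> b\<close> (row \<open>b\<close>, column \<open>c\<close>) in the
  standard basis, and \<open>w\<close> lists the complex coordinates of an eigenvector.\<close>

definition jacobian_eigenvalue :: "('a::euclidean_space \<Rightarrow> 'a) \<Rightarrow> 'a \<Rightarrow> complex \<Rightarrow> bool" where
  "jacobian_eigenvalue F s \<mu> \<longleftrightarrow>
     (\<exists>w :: 'a \<Rightarrow> complex. (\<exists>b\<in>Basis. w b \<noteq> 0) \<and>
       (\<forall>b\<in>Basis. (\<Sum>c\<in>Basis. of_real (frechet_derivative F (at s) c \<bullet> b) * w c) = \<mu> * w b))"

definition linearly_stable_equilibrium ::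
    "'a::euclidean_space set \<Rightarrow> ('a \<Rightarrow> 'a) \<Rightarrow> 'a \<Rightarrow> bool" where
  "linearly_stable_equilibrium D F s \<longleftrightarrow>
     s \<in> D \<and> F s = 0 \<and> F differentiable (at s) \<and> (\<forall>\<mu>. jacobian_eigenvalue F s \<mu> \<longrightarrow> Re \<mu> < 0)"

definition outer :: "real^'n \<Rightarrow> real^'n^'n" where
  "outer v = (columnvector v :: real^1^'n) ** rowvector v"

definition rayleigh :: "(real^'n \<Rightarrow> real) \<Rightarrow> real^'n \<Rightarrow> real^'n \<Rightarrow> real" where
  "rayleigh E x v = v \<bullet> (hessian E x *v v)"

text \<open>The tuple \<open>(v\<^sub>1, \<dots>, v\<^sub>k)\<close> is a vector \<open>v :: real^'n^'k\<close>; the finite linearly ordered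
  index type \<open>'k\<close> plays the role of \<open>{1, \<dots>, k}\<close> and \<open>pos\<close> is the order isomorphism.\<close>

definition pos :: "'k::{finite,linorder} \<Rightarrow> nat" where
  "pos i = card {..i}"

definition saddle_domain :: "(real^'n \<Rightarrow> real) \<Rightarrow> ((real^'n) \<times> (real^'n^'k)) set" where
  "saddle_domain E = {(x, v). \<forall>i. rayleigh E x (v $ i) \<noteq> 0}"

definition saddle_rhs :: "real \<Rightarrow> real \<Rightarrow> real \<Rightarrow> (real^'n \<Rightarrow> real) \<Rightarrow>
    (real^'n) \<times> (real^'n^'k::{finite,linorder}) \<Rightarrow> (real^'n) \<times> (real^'n^'k::{finite,linorder})" where
  "saddle_rhs \<beta> \<gamma> \<eta> E = (\<lambda>(x, v).
     (- \<beta> *\<^sub>R ((mat 1 - (\<Sum>i\<in>UNIV. (1 + \<eta> / \<bar>rayleigh E x (v $ i)\<bar>) *\<^sub>R outer (v $ i)))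
               *v gradient E x),
      \<chi> i. - \<gamma> *\<^sub>R ((mat 1 - outer (v $ i) - (\<Sum>j\<in>{..<i}. 2 *\<^sub>R outer (v $ j)))
               *v (hessian E x *v (v $ i)))))"

end

theory Submission
  imports Defs
begin

text \<open>At an equilibrium the \<open>v\<close>-equations force, one index after the other, \<open>v\<^sub>i\<close> to be an
  eigenvector of the Hessian orthogonal to \<open>v\<^sub>1, \<dots>, v\<^sub>i\<^sub>-\<^sub>1\<close>; this uses \<open>\<alpha>\<^sub>i \<noteq> 0\<close>. The matrix in the
  \<open>x\<close>-equation is then invertible, so the gradient vanishes. Consequently the Jacobian is block
  lower triangular, and every diagonal block is diagonal in a common orthonormal eigenbasis of the
  Hessian. The \<open>x\<close>-block has eigenvalues \<open>\<beta>\<eta> sgn \<mu>\<^sub>j\<close> on \<open>v\<^sub>j\<close> and \<open>- \<beta>\<lambda>\<close> on the remaining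
  eigenvectors; the \<open>v\<^sub>i\<close>-block has \<open>\<gamma>(\<mu>\<^sub>i + \<mu>\<^sub>j)\<close> on \<open>v\<^sub>j\<close> for \<open>j \<le> i\<close>, \<open>- \<gamma>(\<mu>\<^sub>j - \<mu>\<^sub>i)\<close> for \<open>j > i\<close> and
  \<open>- \<gamma>(\<lambda> - \<mu>\<^sub>i)\<close> on the rest. All of them are negative exactly if \<open>\<mu>\<^sub>1 < \<dots> < \<mu>\<^sub>k < 0\<close> and all other
  eigenvalues are positive.\<close>

section \<open>Symmetric matrices\<close>

lemma symmetric_matrix_inner:
  fixes A :: "real^'n^'n"
  assumes "transpose A = A"
  shows "(A *v u) \<bullet> w = u \<bullet> (A *v w)"
  using dot_lmul_matrix[of u A w] transpose_matrix_vector[of A u] assms by simp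

text \<open>Variational argument: a maximiser of the Rayleigh quotient over the compact unit sphere
  of \<open>S\<close> is an eigenvector. Invariance keeps the residual \<open>r\<close> inside
  \<open>S\<close>, so \<open>r\<close> is an admissible direction of variation, and optimality
  forces it to vanish.\<close>

lemma symmetric_eigenvector_in_invariant_subspace:
  fixes A :: "real^'n^'n"
  assumes sym: "transpose A = A" and S: "subspace S" "S \<noteq> {0}"
    and inv: "\<And>w. w \<in> S \<Longrightarrow> A *v w \<in> S"
  obtains z \<mu> where "z \<in> S" "norm z = 1" "A *v z = \<mu> *\<^sub>R z"
proof -
  have symm: "(A *v u) \<bullet> w = u \<bullet> (A *v w)" for u w
    using sym by (rule symmetric_matrix_inner)
  define K where "K = S \<inter> sphere 0 1"
  obtain y where y: "y \<in> S" "y \<noteq> 0" using S subspace_0 by blast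
  then have "(1 / norm y) *\<^sub>R y \<in> K"
    unfolding K_def using S by (auto intro: subspace_scale)
  then have "K \<noteq> {}" by blast
  moreover have "compact K" unfolding K_def
    using closed_subspace[OF S(1)] by (simp add: closed_Int_compact)
  moreover have "continuous_on K (\<lambda>w. w \<bullet> (A *v w))"
    by (intro continuous_intros linear_continuous_on) auto
  ultimately obtain z where z: "z \<in> K" and max: "\<And>w. w \<in> K \<Longrightarrow> w \<bullet> (A *v w) \<le> z \<bullet> (A *v z)"
    using continuous_attains_sup by metis
  define \<mu> where "\<mu> = z \<bullet> (A *v z)"
  have zS: "z \<in> S" and z1: "norm z = 1" using z by (auto simp: K_def)
  define q where "q w = \<mu> * (w \<bullet> w) - w \<bullet> (A *v w)" for w
  have q0: "q w \<ge> 0" if "w \<in> S" for w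
  proof (cases "w = 0")
    case False
    have "(1 / norm w) *\<^sub>R w \<in> K"
      unfolding K_def using S that False by (auto intro: subspace_scale)
    from max[OF this] have "w \<bullet> (A *v w) / (norm w)\<^sup>2 \<le> \<mu>"
      by (simp add: matrix_vector_mult_scaleR \<mu>_def power2_eq_square)
    then show ?thesis using False
      by (simp add: q_def divide_le_eq power2_norm_eq_inner)
  qed (simp add: q_def)
  define r where "r = \<mu> *\<^sub>R z - A *v z"
  have rS: "r \<in> S" unfolding r_def using S zS inv by (intro subspace_diff subspace_scale)
  text \<open>\<open>z\<close> minimises the nonnegative form \<open>q\<close> on \<open>S\<close>, so the linear term in \<open>t\<close> vanishes.\<close>
  have expand: "q (z + t *\<^sub>R r) = t * (2 * (r \<bullet> r)) + t * t * q r" for t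
  proof -
    have "z \<bullet> z = 1" using z1 by (simp add: dot_square_norm)
    then have "q z = 0" by (simp add: q_def \<mu>_def)
    have "q (z + t *\<^sub>R r) = q z + t * (2 * (\<mu> * (z \<bullet> r) - (A *v z) \<bullet> r)) + t * t * q r"
      by (simp add: q_def matrix_vector_right_distrib matrix_vector_mult_scaleR inner_add_left
          inner_add_right symm[of z r, symmetric] inner_commute[of r z] inner_commute[of r "A *v z"])
        (simp add: algebra_simps)
    moreover have "(\<mu> *\<^sub>R z - A *v z) \<bullet> r = r \<bullet> r" by (simp only: r_def)
    ultimately show ?thesis using \<open>q z = 0\<close> by (simp add: inner_diff_left)
  qed
  have "r \<bullet> r \<le> 0"
  proof (rule ccontr)
    assume "\<not> r \<bullet> r \<le> 0"
    then have rr: "r \<bullet> r > 0" by linarith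
    \<comment> \<open>A negative step so short that the linear term outweighs the quadratic one; the
      summand 1 keeps the denominator positive when \<open>q r\<close> is zero.\<close>
    define t where "t = - (r \<bullet> r) / (q r + 1)"
    have qr: "q r \<ge> 0" using q0 rS by blast
    have t: "t < 0" unfolding t_def using rr qr by (simp add: divide_neg_pos)
    have "t * q r > - (2 * (r \<bullet> r))"
    proof -
      have "(r \<bullet> r) * (q r / (q r + 1)) \<le> (r \<bullet> r) * 1"
        using rr qr by (intro mult_left_mono) auto
      moreover have "t * q r = - ((r \<bullet> r) * (q r / (q r + 1)))" by (simp add: t_def)
      ultimately show ?thesis using rr by linarith
    qed
    then have "t * (2 * (r \<bullet> r) + t * q r) < 0"
      using t by (simp add: mult_neg_pos)
    moreover have "0 \<le> q (z + t *\<^sub>R r)"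
      using S zS rS by (intro q0 subspace_add subspace_scale)
    ultimately show False by (simp add: expand algebra_simps)
  qed
  then have "r = 0" by (metis inner_ge_zero inner_eq_zero_iff order_antisym)
  then show ?thesis using that[OF zS z1, of \<mu>] by (simp add: r_def)
qed

definition orthonormal :: "'a::real_inner set \<Rightarrow> bool" where
  "orthonormal B \<longleftrightarrow> (\<forall>b\<in>B. norm b = 1) \<and> pairwise orthogonal B"

lemma orthonormal_independent: "orthonormal B \<Longrightarrow> independent (B :: 'a::euclidean_space set)"
  unfolding orthonormal_def by (intro pairwise_orthogonal_independent) auto

text \<open>Induction on the number of missing vectors: the orthogonal complement of a set of
  eigenvectors is invariant under a symmetric matrix, so it supplies a further unit eigenvector
  until the dimension is exhausted. Starting from a prescribed \<open>B\<close> later allows all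
  \<open>v $ i\<close> to be kept in the basis.\<close>

lemma orthonormal_eigenbasis_extend:
  fixes A :: "real^'n^'n"
  assumes sym: "transpose A = A"
    and "orthonormal B" "\<And>b. b \<in> B \<Longrightarrow> \<exists>\<mu>. A *v b = \<mu> *\<^sub>R b"
  obtains C where "B \<subseteq> C" "orthonormal C" "card C = CARD('n)"
    "\<And>b. b \<in> C \<Longrightarrow> \<exists>\<mu>. A *v b = \<mu> *\<^sub>R b"
proof -
  have symm: "(A *v u) \<bullet> w = u \<bullet> (A *v w)" for u w
    using sym by (rule symmetric_matrix_inner)
  have "\<exists>C. B \<subseteq> C \<and> orthonormal C \<and> card C = CARD('n) \<and> (\<forall>b\<in>C. \<exists>\<mu>. A *v b = \<mu> *\<^sub>R b)"
    using assms(2,3)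
  proof (induction "CARD('n) - card B" arbitrary: B)
    case 0
    have "card B \<le> CARD('n)"
      using independent_bound[OF orthonormal_independent[OF \<open>orthonormal B\<close>]] by simp
    then show ?case using 0 by (intro exI[of _ B]) auto
  next
    case (Suc m)
    define S where "S = {y. \<forall>b\<in>B. orthogonal b y}"
    have fin: "finite B"
      using independent_bound[OF orthonormal_independent[OF \<open>orthonormal B\<close>]] by simp
    have "S \<noteq> {0}"
    proof
      assume "S = {0}"
      have "dim B \<le> card B" using dim_le_card' fin by blast
      then have "dim (span B) < dim (UNIV :: (real^'n) set)" using Suc by simp
      then obtain y where y: "y \<noteq> 0" "\<And>w. w \<in> span B \<Longrightarrow> orthogonal y w"
        using orthogonal_to_subspace_exists[of B] by auto
      then have "y \<in> S" unfolding S_def by (auto simp: span_base orthogonal_commute)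
      with \<open>S = {0}\<close> y show False by simp
    qed
    moreover have "subspace S" unfolding S_def by (rule subspace_orthogonal_to_vectors)
    moreover have "A *v w \<in> S" if "w \<in> S" for w
    proof -
      have "b \<bullet> (A *v w) = 0" if "b \<in> B" for b
      proof -
        obtain \<mu> where "A *v b = \<mu> *\<^sub>R b" using Suc.prems \<open>b \<in> B\<close> by blast
        then show ?thesis using \<open>w \<in> S\<close> \<open>b \<in> B\<close>
          by (simp add: symm[symmetric] S_def orthogonal_def)
      qed
      then show ?thesis by (simp add: S_def orthogonal_def)
    qed
    ultimately obtain z \<mu> where z: "z \<in> S" "norm z = 1" "A *v z = \<mu> *\<^sub>R z"
      using symmetric_eigenvector_in_invariant_subspace[OF sym] by metis
    have "z \<notin> B" using z by (auto simp: S_def orthogonal_def)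
    have "orthonormal (insert z B)"
      using z Suc.prems by (auto simp: orthonormal_def S_def pairwise_insert orthogonal_commute)
    moreover have "m = CARD('n) - card (insert z B)" using Suc.hyps fin \<open>z \<notin> B\<close> by simp
    ultimately show ?case
      using Suc.hyps(1)[of "insert z B"] z(3) Suc.prems by blast
  qed
  then show ?thesis using that by blast
qed

lemma orthonormal_basis_expansion:
  fixes B :: "(real^'n) set"
  assumes "orthonormal B" "card B = CARD('n)"
  shows "z = (\<Sum>b\<in>B. (z \<bullet> b) *\<^sub>R b)"
proof -
  have fin: "finite B" using assms by (metis card.infinite zero_less_card_finite less_irrefl)
  have "z \<in> span B"
    using card_eq_dim[of B UNIV] orthonormal_independent[OF assms(1)] assms fin by auto
  then obtain c where c: "z = (\<Sum>b\<in>B. c b *\<^sub>R b)" using span_finite[OF fin] by auto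
  have "z \<bullet> b = c b" if "b \<in> B" for b
  proof -
    have "z \<bullet> b = (\<Sum>a\<in>B. c a * (a \<bullet> b))" by (simp add: c inner_sum_left)
    also have "\<dots> = (\<Sum>a\<in>B. if a = b then c b else 0)"
      using assms(1) that
      by (intro sum.cong) (auto simp: orthonormal_def pairwise_def orthogonal_def norm_eq_1)
    finally show ?thesis using that fin by simp
  qed
  then have "(\<Sum>b\<in>B. c b *\<^sub>R b) = (\<Sum>b\<in>B. (z \<bullet> b) *\<^sub>R b)" by (intro sum.cong) auto
  with c show ?thesis by (rule trans)
qed

text \<open>In coordinates with respect to \<open>B\<close> the quadratic form is a sum of squares
  with negative weights, and at least one square is nonzero.\<close>

lemma orthonormal_eigenbasis_negative_definite:
  fixes J :: "real^'n \<Rightarrow> real^'n"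
  assumes "linear J" "orthonormal B" "card B = CARD('n)"
    and J: "\<And>b. b \<in> B \<Longrightarrow> \<exists>\<rho><0. J b = \<rho> *\<^sub>R b" and "z \<noteq> 0"
  shows "z \<bullet> J z < 0"
proof -
  obtain \<rho> where J: "\<And>b. b \<in> B \<Longrightarrow> J b = \<rho> b *\<^sub>R b" "\<And>b. b \<in> B \<Longrightarrow> \<rho> b < 0"
    using J by metis
  have fin: "finite B" using assms by (metis card.infinite zero_less_card_finite less_irrefl)
  have z: "z = (\<Sum>b\<in>B. (z \<bullet> b) *\<^sub>R b)" using orthonormal_basis_expansion assms by blast
  have "J z = (\<Sum>b\<in>B. (z \<bullet> b) *\<^sub>R J b)"
    by (subst z) (simp add: linear_sum[OF assms(1)] linear_cmul[OF assms(1)])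
  also have "\<dots> = (\<Sum>b\<in>B. ((z \<bullet> b) * \<rho> b) *\<^sub>R b)"
    using J by (intro sum.cong) auto
  finally have zJ: "z \<bullet> J z = (\<Sum>b\<in>B. \<rho> b * (z \<bullet> b)\<^sup>2)"
    by (simp add: inner_sum_right power2_eq_square algebra_simps)
  obtain b where b: "b \<in> B" "z \<bullet> b \<noteq> 0"
    using z \<open>z \<noteq> 0\<close> by (metis (no_types, lifting) scaleR_zero_left sum.neutral)
  have "0 < (\<Sum>b\<in>B. - (\<rho> b * (z \<bullet> b)\<^sup>2))"
    using b fin J(2)[OF b(1)] by (intro sum_pos2[of B b]) (auto simp: mult_neg_pos J(2) mult_nonpos_nonneg less_imp_le)
  then show ?thesis by (simp add: zJ sum_negf)
qed

section \<open>Characteristic polynomials and eigenvalue multisets\<close>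

text \<open>The embedding \<open>C\<close> of entries as constant polynomials is multiplicative, and
  the scalar matrix of the indeterminate commutes with every matrix. Hence the characteristic matrix
  itself is conjugated by \<open>C P\<close>, and the determinants of the two outer factors multiply
  to 1.\<close>

lemma charpoly_orthogonal_similar:
  fixes A P :: "real^'n^'n"
  assumes "transpose P ** P = mat 1"
  shows "charpoly (transpose P ** A ** P) = charpoly A"
proof -
  define C where "C = (map_matrix (\<lambda>a. [:a:]) :: real^'n^'n \<Rightarrow> (real poly)^'n^'n)"
  have C_mult: "C (M ** N) = C M ** C N" for M N
    by (simp add: C_def vec_eq_iff matrix_matrix_mult_def flip: sum_to_poly mult_pCons_left)
      (simp add: mult.commute sum_to_poly)
  have C1: "C (mat 1) = mat 1" by (simp add: C_def vec_eq_iff mat_def)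
  have matrix_diff_ldistrib: "L ** (M - N) = L ** M - L ** N"
    and matrix_diff_rdistrib: "(M - N) ** L = M ** L - N ** L" for L M N :: "(real poly)^'n^'n"
    by (simp_all add: vec_eq_iff matrix_matrix_mult_def algebra_simps sum_subtractf)
  have X: "N ** (mat [:0, 1:] ** M) = mat [:0,1:] ** (N ** M)" for M N :: "(real poly)^'n^'n"
    by (simp add: vec_eq_iff matrix_matrix_mult_def mat_def if_distrib if_distribR sum_distrib_left
        cong: if_cong)
  have 1: "C (transpose P) ** C P = mat 1" using assms by (simp add: C1 flip: C_mult)
  have "mat [:0, 1:] - C (transpose P ** A ** P) = C (transpose P) ** (mat [:0,1:] - C A) ** C P"
    by (simp add: C_mult matrix_diff_ldistrib matrix_diff_rdistrib matrix_mul_assoc[symmetric] X 1)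
  then have "charpoly (transpose P ** A ** P) = det (C (transpose P)) * charpoly A * det (C P)"
    by (simp add: charpoly_def C_def[symmetric] det_mul)
  also have "\<dots> = det (C (transpose P) ** C P) * charpoly A" by (simp add: det_mul)
  finally show ?thesis by (simp add: 1)
qed

text \<open>Conjugation by the orthogonal matrix \<open>P\<close> with the basis vectors as columns
  makes \<open>A\<close> diagonal, so the characteristic polynomial splits into linear factors, one
  for each basis vector.\<close>

lemma eigenvalues_eigenbasis:
  fixes A :: "real^'n^'n"
  assumes "orthonormal B" "card B = CARD('n)" and f: "\<And>b. b \<in> B \<Longrightarrow> A *v b = f b *\<^sub>R b"
  shows "eigenvalues A = image_mset f (mset_set B)"
proof -
  have fin: "finite B" using assms by (metis card.infinite zero_less_card_finite less_irrefl)
  obtain e :: "'n \<Rightarrow> real^'n" where e: "bij_betw e UNIV B"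
    using assms(2) fin by (metis finite_class.finite_UNIV finite_same_card_bij)
  define P :: "real^'n^'n" where "P = (\<chi> i j. e j $ i)"
  have eB: "e i \<in> B" for i using e by (auto simp: bij_betw_def)
  have ee: "e i \<bullet> e j = (if i = j then 1 else 0)" for i j
  proof (cases "i = j")
    case False
    then have "e i \<noteq> e j" using e by (auto simp: bij_betw_def inj_def)
    then show ?thesis using False eB[of i] eB[of j] assms(1)
      by (simp add: orthonormal_def pairwise_def orthogonal_def)
  qed (use eB[of i] assms(1) in \<open>simp add: orthonormal_def norm_eq_1\<close>)
  have PM: "(transpose P ** M ** P) $ i $ j = e i \<bullet> (M *v e j)" for M i j
    by (simp add: P_def flip: matrix_mul_assoc)
      (simp add: matrix_matrix_mult_def transpose_def inner_vec_def
        matrix_vector_mult_def)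
  have "transpose P ** P = mat 1"
    using PM[of "mat 1"] by (simp add: vec_eq_iff ee) (simp add: mat_def)
  moreover have PAP: "(transpose P ** A ** P) $ i $ j = (if i = j then f (e i) else 0)" for i j
    by (simp add: PM f[OF eB] ee)
  ultimately have "charpoly A = charpoly (transpose P ** A ** P)"
    using charpoly_orthogonal_similar by metis
  also have "\<dots> = (\<Prod>i\<in>UNIV. [:- f (e i), 1:])"
    unfolding charpoly_def by (subst det_diagonal) (auto simp: PAP mat_def)
  also have "\<dots> = (\<Prod>b\<in>B. [:- f b, 1:])"
    using prod.reindex_bij_betw[OF e] by simp
  finally have "eigenvalues A = (\<Sum>b\<in>B. {#f b#})"
    by (simp add: eigenvalues_def proots_prod)
  also have "\<dots> = image_mset f (mset_set B)"
    using fin by (simp add: sum_unfold_sum_mset)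
  finally show ?thesis .
qed

section \<open>Spectra of block triangular derivatives\<close>

text \<open>The image of \<open>W\<close> under \<open>U\<close>, that is, T minus \<rho>, is
  orthogonal to \<open>z\<close>, so \<open>U\<close> is not onto \<open>W\<close> and, by
  dimension, not injective on it. For block triangular maps such a left eigenvector is explicit,
  whereas a right one would involve the off-diagonal blocks.\<close>

lemma left_eigenvector_imp_eigenvector_on:
  fixes T :: "'a::euclidean_space \<Rightarrow> 'a"
  assumes T: "linear T" and W: "subspace W" "\<And>w. w \<in> W \<Longrightarrow> T w \<in> W"
    and z: "z \<in> W" "z \<noteq> 0" "\<And>w. w \<in> W \<Longrightarrow> z \<bullet> T w = \<rho> * (z \<bullet> w)"
  obtains w where "w \<in> W" "w \<noteq> 0" "T w = \<rho> *\<^sub>R w"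
proof -
  define U where "U w = T w - \<rho> *\<^sub>R w" for w
  have U: "linear U" unfolding U_def
    using T by (simp add: linear_iff algebra_simps)
  have UW: "U ` W \<subseteq> W" unfolding U_def using W by (auto intro: subspace_diff subspace_scale)
  have "z \<notin> U ` W"
  proof
    assume "z \<in> U ` W"
    then obtain w where "w \<in> W" "z = U w" by blast
    then have "z \<bullet> z = 0" using z by (simp add: U_def inner_diff_right)
    then show False using z by simp
  qed
  moreover have "U ` W = W" if "inj_on U W"
  proof (rule subspace_dim_equal)
    show "dim (U ` W) \<ge> dim W"
      using dim_image_eq[OF U, of W] that W(1) by (metis order_refl span_eq_iff)
  qed (use U UW W in \<open>auto intro: linear_subspace_image\<close>)
  ultimately have "\<not> inj_on U W" using z by auto
  then obtain a b where ab: "a \<in> W" "b \<in> W" "a \<noteq> b" "U a = U b" by (auto simp: inj_on_def)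
  have "U (a - b) = 0" using ab linear_diff[OF U] by simp
  then show ?thesis using ab W that[of "a - b"] by (auto simp: U_def subspace_diff)
qed

lemma jacobian_eigenvalue_of_real:
  assumes F: "(F has_derivative L) (at s)" and w: "w \<noteq> 0" "L w = \<rho> *\<^sub>R w"
  shows "jacobian_eigenvalue F s (of_real \<rho>)"
  unfolding jacobian_eigenvalue_def frechet_derivative_at[OF F, symmetric]
proof (intro exI conjI ballI)
  show "\<exists>b\<in>Basis. of_real (w \<bullet> b) \<noteq> (0::complex)"
    using w(1) by (simp add: euclidean_all_zero_iff flip: ex_simps) (use euclidean_all_zero_iff in blast)
  fix b :: 'a assume "b \<in> Basis"
  have "L w = (\<Sum>c\<in>Basis. (w \<bullet> c) *\<^sub>R L c)"
    using linear_sum[OF has_derivative_linear[OF F]] linear_cmul[OF has_derivative_linear[OF F]]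
    by (metis (no_types, lifting) euclidean_representation sum.cong)
  then have "(\<Sum>c\<in>Basis. (L c \<bullet> b) * (w \<bullet> c)) = \<rho> * (w \<bullet> b)"
    using w(2) by (simp add: inner_sum_left mult.commute flip: inner_scaleR_left)
  then show "(\<Sum>c\<in>Basis. complex_of_real (L c \<bullet> b) * of_real (w \<bullet> c)) = of_real \<rho> * of_real (w \<bullet> b)"
    by (simp flip: of_real_mult of_real_sum)
qed

text \<open>Splitting a complex eigenvector into real and imaginary parts turns the spectral
  condition into two real equations, to which real inner products apply.\<close>

lemma jacobian_eigenvalueE:
  assumes F: "(F has_derivative L) (at s)" and \<mu>: "jacobian_eigenvalue F s \<mu>"
  obtains u y where "u \<noteq> 0 \<or> y \<noteq> 0" "L u = Re \<mu> *\<^sub>R u - Im \<mu> *\<^sub>R y" "L y = Im \<mu> *\<^sub>R u + Re \<mu> *\<^sub>R y"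
proof -
  have L: "linear L" using F by (rule has_derivative_linear)
  obtain w where w: "\<exists>b\<in>Basis. w b \<noteq> 0"
    and eq: "\<And>b. b \<in> Basis \<Longrightarrow> (\<Sum>c\<in>Basis. of_real (L c \<bullet> b) * w c) = \<mu> * w b"
    using \<mu> unfolding jacobian_eigenvalue_def frechet_derivative_at[OF F, symmetric] by blast
  define u y where "u = (\<Sum>c\<in>Basis. Re (w c) *\<^sub>R c)" and "y = (\<Sum>c\<in>Basis. Im (w c) *\<^sub>R c)"
  have uy: "u \<bullet> b = Re (w b)" "y \<bullet> b = Im (w b)" if "b \<in> Basis" for b
    using that by (simp_all add: u_def y_def inner_sum_left inner_Basis if_distrib cong: if_cong)
  have "L u \<bullet> b = (\<Sum>c\<in>Basis. (L c \<bullet> b) * Re (w c))" "L y \<bullet> b = (\<Sum>c\<in>Basis. (L c \<bullet> b) * Im (w c))" for b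
    by (simp_all add: u_def y_def linear_sum[OF L] linear_cmul[OF L] inner_sum_left mult.commute)
  then have "L u \<bullet> b = Re (\<mu> * w b)" "L y \<bullet> b = Im (\<mu> * w b)" if "b \<in> Basis" for b
    by (simp_all flip: eq[OF that] add: Re_sum Im_sum)
  then have "L u = Re \<mu> *\<^sub>R u - Im \<mu> *\<^sub>R y" "L y = Im \<mu> *\<^sub>R u + Re \<mu> *\<^sub>R y"
    by (simp_all add: euclidean_eq_iff[where 'a='a] inner_diff_left inner_add_left uy)
  moreover have "u \<noteq> 0 \<or> y \<noteq> 0"
    using w uy by (metis complex_eq_iff inner_zero_left zero_complex.sel)
  ultimately show ?thesis using that by blast
qed

text \<open>Pair the first equation with \<open>u\<close> and the second with \<open>y\<close>: the
  two terms with \<open>b\<close> cancel, and \<open>a\<close> times a sum of squared norms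
  remains.\<close>

lemma negative_definite_imp_Re_neg:
  fixes J :: "'a::real_inner \<Rightarrow> 'a"
  assumes J: "\<And>z. z \<noteq> 0 \<Longrightarrow> z \<bullet> J z < 0" and "u \<noteq> 0 \<or> y \<noteq> 0"
    and "J u = a *\<^sub>R u - b *\<^sub>R y" "J y = b *\<^sub>R u + a *\<^sub>R y"
  shows "a < 0"
proof -
  have J': "z \<bullet> J z \<le> 0" if "z \<in> {u, y}" for z
    using J[of z] by (cases "z = 0") auto
  have "u \<bullet> J u + y \<bullet> J y < 0"
    using assms(2) J[of u] J[of y] J'[of u] J'[of y] by auto
  also have "u \<bullet> J u + y \<bullet> J y = a * (u \<bullet> u + y \<bullet> y)"
    by (simp add: assms inner_diff_right inner_add_right inner_commute[of y u] algebra_simps)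
  finally show ?thesis by (simp add: mult_less_0_iff) (metis add_nonneg_nonneg inner_ge_zero not_less)
qed

text \<open>Only the vanishing blocks and the diagonal ones are prescribed. How component
  \<open>i\<close> reacts to the first factor and to components below \<open>i\<close> is left open,
  so the derivative of the Hessian never has to be computed.\<close>

definition block_triangular ::
    "('a::real_vector \<times> ('b::real_vector^'k::{finite,linorder}) \<Rightarrow> 'a \<times> ('b^'k::{finite,linorder})) \<Rightarrow>
     ('a \<Rightarrow> 'a) \<Rightarrow> ('k::{finite,linorder} \<Rightarrow> 'b \<Rightarrow> 'b) \<Rightarrow> bool" where
  "block_triangular L J0 J \<longleftrightarrow> (\<forall>h k. fst (L (h, k)) = J0 h) \<and>
     (\<forall>k i. (\<forall>j<i. k $ j = 0) \<longrightarrow> snd (L (0, k)) $ i = J i (k $ i))"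

text \<open>Look at the first block, in the order of the triangular structure, where a complex
  eigenvector is nonzero. On that block the eigenvalue equation involves the diagonal block alone,
  which is negative definite.\<close>

lemma block_triangular_Re_neg:
  fixes J0 :: "'a::euclidean_space \<Rightarrow> 'a" and J :: "'k::{finite,linorder} \<Rightarrow> 'b::euclidean_space \<Rightarrow> 'b"
  assumes F: "(F has_derivative L) (at s)" and tri: "block_triangular L J0 J"
    and J0: "\<And>z. z \<noteq> 0 \<Longrightarrow> z \<bullet> J0 z < 0" and J: "\<And>i z. z \<noteq> 0 \<Longrightarrow> z \<bullet> J i z < 0"
    and "jacobian_eigenvalue F s \<mu>"
  shows "Re \<mu> < 0"
proof -
  obtain u y where "u \<noteq> 0 \<or> y \<noteq> 0"
    "L u = Re \<mu> *\<^sub>R u - Im \<mu> *\<^sub>R y" "L y = Im \<mu> *\<^sub>R u + Re \<mu> *\<^sub>R y"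
    using jacobian_eigenvalueE[OF F assms(5)] by metis
  moreover obtain u1 u2 y1 y2 where uy: "u = (u1, u2)" "y = (y1, y2)" by fastforce
  ultimately have nz: "(u1, u2) \<noteq> 0 \<or> (y1, y2) \<noteq> 0"
    and Lu: "L (u1, u2) = Re \<mu> *\<^sub>R (u1, u2) - Im \<mu> *\<^sub>R (y1, y2)"
    and Ly: "L (y1, y2) = Im \<mu> *\<^sub>R (u1, u2) + Re \<mu> *\<^sub>R (y1, y2)" by auto
  show ?thesis
  proof (cases "u1 \<noteq> 0 \<or> y1 \<noteq> 0")
    case True
    moreover have "J0 u1 = Re \<mu> *\<^sub>R u1 - Im \<mu> *\<^sub>R y1" "J0 y1 = Im \<mu> *\<^sub>R u1 + Re \<mu> *\<^sub>R y1"
      using arg_cong[OF Lu, of fst] arg_cong[OF Ly, of fst] tri by (simp_all add: block_triangular_def)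
    ultimately show ?thesis using negative_definite_imp_Re_neg[of J0] J0 by metis
  next
    case False
    define i where "i = Min {i. u2 $ i \<noteq> 0 \<or> y2 $ i \<noteq> 0}"
    have "{i. u2 $ i \<noteq> 0 \<or> y2 $ i \<noteq> 0} \<noteq> {}"
      using nz False by (auto simp: zero_prod_def vec_eq_iff)
    then have i: "u2 $ i \<noteq> 0 \<or> y2 $ i \<noteq> 0"
      unfolding i_def using Min_in[of "{i. u2 $ i \<noteq> 0 \<or> y2 $ i \<noteq> 0}"] by simp
    have less: "u2 $ j = 0 \<and> y2 $ j = 0" if "j < i" for j
      using that Min_le[of "{i. u2 $ i \<noteq> 0 \<or> y2 $ i \<noteq> 0}" j] unfolding i_def by fastforce
    have "J i (u2 $ i) = Re \<mu> *\<^sub>R u2 $ i - Im \<mu> *\<^sub>R y2 $ i" "J i (y2 $ i) = Im \<mu> *\<^sub>R u2 $ i + Re \<mu> *\<^sub>R y2 $ i"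
      using arg_cong[OF Lu, of "\<lambda>p. snd p $ i"] arg_cong[OF Ly, of "\<lambda>p. snd p $ i"] tri False less
      by (simp_all add: block_triangular_def)
    then show ?thesis using negative_definite_imp_Re_neg[of "J i"] J i by metis
  qed
qed

text \<open>Since the first component of \<open>L\<close> depends on the first argument only,
  \<open>(z, 0)\<close> is a left eigenvector on the whole space.\<close>

lemma block_triangular_fst_eigenvalue:
  fixes J0 :: "'a::euclidean_space \<Rightarrow> 'a" and J :: "'k::{finite,linorder} \<Rightarrow> 'b::euclidean_space \<Rightarrow> 'b"
  assumes F: "(F has_derivative L) (at s)" and tri: "block_triangular L J0 J"
    and J0: "\<And>w. z \<bullet> J0 w = J0 z \<bullet> w" and z: "z \<noteq> 0" "J0 z = \<rho> *\<^sub>R z"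
  shows "jacobian_eigenvalue F s (of_real \<rho>)"
proof -
  have "(z, 0) \<bullet> L w = \<rho> * ((z, 0) \<bullet> w)" for w
    using J0 z tri by (cases w) (simp add: block_triangular_def inner_prod_def)
  then obtain w where "w \<noteq> 0" "L w = \<rho> *\<^sub>R w"
    using left_eigenvector_imp_eigenvector_on[of L UNIV "(z, 0)" \<rho>] has_derivative_linear[OF F] z(1)
    by (metis UNIV_I fst_conv subspace_UNIV fst_zero)
  then show ?thesis using jacobian_eigenvalue_of_real[OF F] by blast
qed

text \<open>The unspecified couplings disappear on the invariant subspace \<open>W\<close> of
  vectors that vanish before component \<open>i\<close>; there \<open>(0, axis i z)\<close> is a
  left eigenvector.\<close>

lemma block_triangular_snd_eigenvalue:
  fixes J0 :: "'a::euclidean_space \<Rightarrow> 'a" and J :: "'k::{finite,linorder} \<Rightarrow> 'b::euclidean_space \<Rightarrow> 'b"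
  assumes F: "(F has_derivative L) (at s)" and tri: "block_triangular L J0 J"
    and J: "\<And>w. z \<bullet> J i w = J i z \<bullet> w" and z: "z \<noteq> 0" "J i z = \<rho> *\<^sub>R z"
  shows "jacobian_eigenvalue F s (of_real \<rho>)"
proof -
  have L: "linear L" using F by (rule has_derivative_linear)
  define W :: "('a \<times> ('b^'k::{finite,linorder})) set" where "W = {(h, k). h = 0 \<and> (\<forall>j<i. k $ j = 0)}"
  have "subspace W" by (auto simp: W_def subspace_def zero_prod_def)
  moreover have "L w \<in> W" if wW: "w \<in> W" for w
  proof -
    have J00: "J0 0 = 0" and Jj0: "J j 0 = 0" for j
      using tri linear_0[OF L] by (auto simp: block_triangular_def zero_prod_def dest!: spec[of _ 0])
    obtain k where k: "w = (0, k)" "\<forall>j<i. k $ j = 0" using wW by (auto simp: W_def)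
    have "fst (L w) = 0" using tri k J00 by (simp add: block_triangular_def)
    moreover have "snd (L w) $ j = 0" if "j < i" for j
      using tri k that Jj0 by (auto simp: block_triangular_def)
    ultimately show ?thesis by (cases "L w") (simp add: W_def)
  qed
  moreover have "(0, axis i z) \<in> W" by (simp add: W_def axis_def)
  moreover have "(0::'a, axis i z) \<noteq> 0" using z(1) by (auto simp: zero_prod_def vec_eq_iff axis_def)
  moreover have "(0, axis i z) \<bullet> L w = \<rho> * ((0, axis i z) \<bullet> w)" if "w \<in> W" for w
    using that J z(2) tri by (cases w) (simp add: W_def block_triangular_def inner_prod_def inner_axis')
  ultimately obtain w where "w \<noteq> 0" "L w = \<rho> *\<^sub>R w"
    using left_eigenvector_imp_eigenvector_on[of L W "(0, axis i z)" \<rho>] L by metis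
  then show ?thesis using jacobian_eigenvalue_of_real[OF F] by blast
qed

section \<open>Positions in the index type and increasing enumerations\<close>

lemma strict_mono_pos: "strict_mono (pos :: 'k::{finite,linorder} \<Rightarrow> nat)"
  unfolding pos_def by (intro strict_monoI psubset_card_mono) (auto intro: less_imp_le)

lemma bij_betw_pos: "bij_betw (pos :: 'k::{finite,linorder} \<Rightarrow> nat) UNIV {1..CARD('k)}"
proof (rule bij_betw_imageI)
  show inj: "inj (pos :: 'k \<Rightarrow> nat)"
    using strict_mono_imp_inj_on[OF strict_mono_pos] .
  have "range (pos :: 'k \<Rightarrow> nat) \<subseteq> {1..CARD('k)}"
    by (auto simp: pos_def Suc_le_eq card_gt_0_iff intro!: card_mono)
  then show "range (pos :: 'k \<Rightarrow> nat) = {1..CARD('k)}"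
    using card_image[OF inj] by (intro card_subset_eq) auto
qed

text \<open>The rank of a value within the common range recovers the position of its index, so a
  finite set of reals has only one increasing enumeration.\<close>

lemma strict_mono_range_eq_imp_eq:
  fixes f g :: "'k::{finite,linorder} \<Rightarrow> real"
  assumes f: "strict_mono f" and g: "strict_mono g" and "range f = range g"
  shows "f = g"
proof
  fix i
  have card: "card {y \<in> range h. y \<le> h j} = pos j" if "strict_mono h" for h :: "'k \<Rightarrow> real" and j
  proof -
    have "{y \<in> range h. y \<le> h j} = h ` {..j}" using that by (auto simp: strict_mono_less_eq)
    then show ?thesis
      unfolding pos_def using card_image[of h "{..j}"] strict_mono_imp_inj_on[OF that] by (simp add: inj_on_subset)
  qed
  obtain j where j: "f i = g j" using assms(3) by (metis rangeE rangeI)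
  then have "pos i = pos j" using card[OF f, of i] card[OF g, of j] assms(3) by simp
  then have "i = j" using bij_betw_pos[where 'k='k] by (auto simp: bij_betw_def inj_def)
  then show "f i = g i" using j by simp
qed

section \<open>Derivatives of gradient and Hessian\<close>

text \<open>Schwarz's theorem by second differences: over a small parallelogram with sides
  \<open>s *\<^sub>R h\<close> and \<open>s *\<^sub>R k\<close>, two mean value theorems produce the
  mixed derivative at a nearby point, in either order, and continuity lets the points tend to
  \<open>x\<close>.\<close>

lemma symmetric_second_derivative:
  fixes f :: "'a::euclidean_space \<Rightarrow> real"
  assumes "C_diff 2 f"
  shows "frechet_derivative (\<lambda>y. frechet_derivative f (at y) h) (at x) k
       = frechet_derivative (\<lambda>y. frechet_derivative f (at y) k) (at x) h"
proof -
  define D where "D h y = frechet_derivative f (at y) h" for h y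
  define S where "S h k y = frechet_derivative (D h) (at y) k" for h k y
  have Df: "(f has_derivative (\<lambda>h. D h y)) (at y)" for y
    using assms unfolding D_def
    by (simp add: numeral_2_eq_2 frechet_derivative_works[symmetric])
  have DD: "(D h has_derivative (\<lambda>k. S h k y)) (at y)" for h y
    using assms unfolding S_def D_def
    by (simp add: numeral_2_eq_2 frechet_derivative_works[symmetric])
  have cont: "continuous_on UNIV (S h k)" for h k
    using assms unfolding S_def D_def by (simp add: numeral_2_eq_2)
  have line: "((\<lambda>t. g (c + t *\<^sub>R u)) has_field_derivative G u (c + t *\<^sub>R u)) (at t)"
    if "\<And>y. (g has_derivative (\<lambda>h. G h y)) (at y)" for g :: "'a \<Rightarrow> real" and G c u t
  proof -
    have "((\<lambda>t. g (c + t *\<^sub>R u)) has_derivative (\<lambda>s. G (s *\<^sub>R u) (c + t *\<^sub>R u))) (at t)"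
      by (rule has_derivative_compose[OF _ that]) (auto intro!: derivative_eq_intros)
    moreover have "(\<lambda>s. G (s *\<^sub>R u) (c + t *\<^sub>R u)) = (*) (G u (c + t *\<^sub>R u))"
      using linear_cmul[OF has_derivative_linear[OF that]] by auto
    ultimately show ?thesis by (simp add: has_field_derivative_def)
  qed
  have square: "\<exists>p. norm (p - x) \<le> s * (norm h + norm k) \<and>
      f (x + s *\<^sub>R h + s *\<^sub>R k) - f (x + s *\<^sub>R h) - f (x + s *\<^sub>R k) + f x = s * s * S h k p"
    if s: "s > 0" for s h k
  proof -
    \<comment> \<open>The difference of \<open>f\<close> across the parallelogram in direction
      \<open>k\<close>; the mean value theorem is applied first to \<open>g\<close> in direction
      \<open>h\<close>, then to \<open>D h\<close> in direction \<open>k\<close>.\<close>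
    define g where "g t = f ((x + s *\<^sub>R k) + t *\<^sub>R h) - f (x + t *\<^sub>R h)" for t
    have "DERIV g t :> D h ((x + s *\<^sub>R k) + t *\<^sub>R h) - D h (x + t *\<^sub>R h)" for t
      unfolding g_def by (intro DERIV_diff line Df)
    then obtain t where t: "0 < t" "t < s"
      and 1: "g s - g 0 = (s - 0) * (D h ((x + s *\<^sub>R k) + t *\<^sub>R h) - D h (x + t *\<^sub>R h))"
      using MVT2[OF s, of g "\<lambda>t. D h ((x + s *\<^sub>R k) + t *\<^sub>R h) - D h (x + t *\<^sub>R h)"] by blast
    obtain r where r: "0 < r" "r < s"
      and 2: "D h ((x + t *\<^sub>R h) + s *\<^sub>R k) - D h ((x + t *\<^sub>R h) + 0 *\<^sub>R k)
        = (s - 0) * S h k ((x + t *\<^sub>R h) + r *\<^sub>R k)"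
      using MVT2[OF s, of "\<lambda>r. D h ((x + t *\<^sub>R h) + r *\<^sub>R k)"
          "\<lambda>r. S h k ((x + t *\<^sub>R h) + r *\<^sub>R k)"] line[of "D h" "\<lambda>k. S h k", OF DD] by blast
    have "norm (t *\<^sub>R h + r *\<^sub>R k) \<le> t * norm h + r * norm k"
      using norm_triangle_ineq[of "t *\<^sub>R h" "r *\<^sub>R k"] t r by simp
    also have "\<dots> \<le> s * (norm h + norm k)"
      using t r by (simp add: distrib_left add_mono mult_right_mono)
    finally have "norm ((x + t *\<^sub>R h + r *\<^sub>R k) - x) \<le> s * (norm h + norm k)"
      by (simp add: algebra_simps)
    moreover have "f (x + s *\<^sub>R h + s *\<^sub>R k) - f (x + s *\<^sub>R h) - f (x + s *\<^sub>R k) + f x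
        = s * s * S h k (x + t *\<^sub>R h + r *\<^sub>R k)"
      using 1 2 by (simp add: g_def algebra_simps)
    ultimately show ?thesis by blast
  qed
  have "\<bar>S h k x - S k h x\<bar> < e" if "e > 0" for e
  proof -
    obtain d1 where d1: "d1 > 0" "\<And>y. dist y x < d1 \<Longrightarrow> dist (S h k y) (S h k x) < e / 2"
      using cont[of h k] \<open>e > 0\<close> unfolding continuous_on_iff by (metis UNIV_I half_gt_zero)
    obtain d2 where d2: "d2 > 0" "\<And>y. dist y x < d2 \<Longrightarrow> dist (S k h y) (S k h x) < e / 2"
      using cont[of k h] \<open>e > 0\<close> unfolding continuous_on_iff by (metis UNIV_I half_gt_zero)
    define n where "n = norm h + norm k + 1"
    \<comment> \<open>Since \<open>n\<close> is positive even for \<open>h = k = 0\<close> and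
      strictly exceeds the sum of the norms, both intermediate points fall within the two continuity
      radii.\<close>
    define s where "s = min d1 d2 / n"
    have n: "n > 0" "norm h + norm k < n" unfolding n_def by (auto intro: add_nonneg_pos)
    have s: "s > 0" unfolding s_def using d1 d2 n by simp
    have sn: "s * (norm h + norm k) < min d1 d2"
      using n mult_strict_left_mono[OF n(2) s] by (simp add: s_def)
    obtain p where p: "norm (p - x) \<le> s * (norm h + norm k)"
      "f (x + s *\<^sub>R h + s *\<^sub>R k) - f (x + s *\<^sub>R h) - f (x + s *\<^sub>R k) + f x = s * s * S h k p"
      using square[OF s] by blast
    obtain q where q: "norm (q - x) \<le> s * (norm k + norm h)"
      "f (x + s *\<^sub>R k + s *\<^sub>R h) - f (x + s *\<^sub>R k) - f (x + s *\<^sub>R h) + f x = s * s * S k h q"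
      using square[OF s] by blast
    \<comment> \<open>The second difference is unchanged when \<open>h\<close> and \<open>k\<close>
      are swapped.\<close>
    have "s * s * S h k p = s * s * S k h q"
      using p(2) q(2) by (simp add: algebra_simps)
    then have "S h k p = S k h q" using s by simp
    moreover have "dist (S h k p) (S h k x) < e / 2"
      using p sn by (intro d1) (simp add: dist_norm)
    moreover have "dist (S k h q) (S k h x) < e / 2"
      using q sn by (intro d2) (simp add: dist_norm add.commute)
    ultimately show ?thesis unfolding dist_real_def by linarith
  qed
  then have "S h k x = S k h x" by (metis less_irrefl zero_less_abs_iff right_minus_eq)
  then show ?thesis by (simp add: S_def D_def[abs_def])
qed

text \<open>\<open>C_diff\<close> demands continuity explicitly only at the top order; one order
  lower it comes from differentiability.\<close>

lemma C_diff_SucD: "C_diff (Suc m) f \<Longrightarrow> C_diff m f"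
proof (induction m arbitrary: f)
  case 0
  then show ?case
    by (auto simp: continuous_on_eq_continuous_at intro: differentiable_imp_continuous_within)
next
  case (Suc m)
  from Suc.prems have "C_diff (Suc m) (\<lambda>x. frechet_derivative f (at x) h)" for h
    using C_diff.simps(2) by blast
  with Suc show ?case by simp
qed

lemma C_diff_3_imp_2: "C_diff 3 f \<Longrightarrow> C_diff 2 f"
  unfolding numeral_3_eq_3 numeral_2_eq_2 by (rule C_diff_SucD)

lemma has_derivative_vec_lambda:
  fixes f :: "'a::real_normed_vector \<Rightarrow> 'n::finite \<Rightarrow> 'b::euclidean_space"
  assumes "\<And>i. ((\<lambda>x. f x i) has_derivative (\<lambda>h. f' h i)) (at a)"
  shows "((\<lambda>x. \<chi> i. f x i) has_derivative (\<lambda>h. \<chi> i. f' h i)) (at a)"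
  unfolding has_derivative_componentwise_within[of "\<lambda>x. \<chi> i. f x i"] Basis_vec_def
  using assms by (auto simp: inner_axis intro!: has_derivative_inner_left)

lemma bounded_bilinear_matrix_vector_mult:
  "bounded_bilinear ((*v) :: real^'n^'m \<Rightarrow> real^'n \<Rightarrow> real^'m)"
  unfolding bilinear_conv_bounded_bilinear[symmetric] bilinear_def linear_iff
  by (simp add: matrix_vector_right_distrib matrix_vector_mult_add_rdistrib
      matrix_vector_mult_scaleR scaleR_matrix_vector_assoc)

lemma sum_matrix_vector_mult: "(\<Sum>i\<in>I. M i) *v y = (\<Sum>i\<in>I. M i *v y)"
  for M :: "'i \<Rightarrow> real^'n^'m"
  by (induction I rule: infinite_finite_induct)
    (auto simp: matrix_vector_mult_add_rdistrib)

lemma outer_vector_mult: "outer v *v y = (v \<bullet> y) *\<^sub>R v"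
  by (simp add: outer_def vec_eq_iff matrix_vector_mult_def matrix_matrix_mult_def columnvector_def
      rowvector_def inner_vec_def sum_distrib_left sum_distrib_right mult_ac)

lemma gradient_differentiable:
  assumes "C_diff 2 E"
  shows "gradient E differentiable (at x)"
proof -
  have "((\<lambda>y. \<chi> i. frechet_derivative E (at y) (axis i 1)) has_derivative
      (\<lambda>h. \<chi> i. frechet_derivative (\<lambda>y. frechet_derivative E (at y) (axis i 1)) (at x) h)) (at x)"
    using assms by (intro has_derivative_vec_lambda)
      (simp add: numeral_2_eq_2 frechet_derivative_works[symmetric])
  then show ?thesis unfolding gradient_def[abs_def] by (rule differentiableI)
qed

lemma gradient_has_derivative:
  "C_diff 2 E \<Longrightarrow> (gradient E has_derivative (\<lambda>h. hessian E x *v h)) (at x)"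
  unfolding hessian_def jacobian_works[symmetric] by (rule gradient_differentiable)

lemma hessian_nth:
  assumes "C_diff 2 E"
  shows "hessian E x $ i $ j
       = frechet_derivative (\<lambda>y. frechet_derivative E (at y) (axis i 1)) (at x) (axis j 1)"
proof -
  have "((\<lambda>y. gradient E y $ i) has_derivative (\<lambda>h. (hessian E x *v h) $ i)) (at x)"
    using bounded_linear.has_derivative[OF bounded_linear_vec_nth gradient_has_derivative[OF assms]] .
  then have "frechet_derivative (\<lambda>y. gradient E y $ i) (at x) = (\<lambda>h. (hessian E x *v h) $ i)"
    by (rule frechet_derivative_at[symmetric])
  then show ?thesis
    by (simp add: gradient_def matrix_vector_mult_basis column_def fun_eq_iff)
qed

lemma transpose_hessian: "C_diff 2 E \<Longrightarrow> transpose (hessian E x) = hessian E x"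
  by (simp add: vec_eq_iff transpose_def hessian_nth symmetric_second_derivative)

lemma hessian_differentiable:
  assumes "C_diff 3 E"
  shows "hessian E differentiable (at x)"
proof -
  have C2: "C_diff 2 E" using assms by (rule C_diff_3_imp_2)
  have "((\<lambda>y. \<chi> i. \<chi> j. hessian E y $ i $ j) has_derivative
      (\<lambda>h. \<chi> i. \<chi> j. frechet_derivative (\<lambda>y. hessian E y $ i $ j) (at x) h)) (at x)"
    using assms by (intro has_derivative_vec_lambda)
      (simp add: hessian_nth[OF C2] numeral_3_eq_3 frechet_derivative_works[symmetric])
  then show ?thesis by (simp add: differentiableI)
qed

section \<open>The saddle dynamics\<close>

text \<open>Inner products in place of outer-product matrices give a form to which the
  differentiation rules apply directly.\<close>

lemma saddle_rhs_eq:
  "saddle_rhs \<beta> \<gamma> \<eta> E = (\<lambda>p.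
    (- \<beta> *\<^sub>R (gradient E (fst p) - (\<Sum>i\<in>UNIV. (1 + \<eta> / \<bar>rayleigh E (fst p) (snd p $ i)\<bar>) *\<^sub>R
        ((snd p $ i \<bullet> gradient E (fst p)) *\<^sub>R snd p $ i))),
     \<chi> i. - \<gamma> *\<^sub>R (hessian E (fst p) *v snd p $ i
        - (snd p $ i \<bullet> (hessian E (fst p) *v snd p $ i)) *\<^sub>R snd p $ i
        - (\<Sum>j\<in>{..<i}. 2 *\<^sub>R ((snd p $ j \<bullet> (hessian E (fst p) *v snd p $ i)) *\<^sub>R snd p $ j)))))"
  by (simp add: saddle_rhs_def fun_eq_iff matrix_vector_mult_diff_rdistrib sum_matrix_vector_mult
      outer_vector_mult flip: scaleR_matrix_vector_assoc)

text \<open>A common shape for all diagonal blocks of the Jacobian: a scaled and shifted Hessian,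
  corrected by weighted projections onto the \<open>v $ j\<close>. Symmetry and eigenvectors are
  thus treated once for the \<open>x\<close>-block and every \<open>v\<close>-block.\<close>

definition saddle_block ::
    "real \<Rightarrow> real^'n^'n \<Rightarrow> real \<Rightarrow> ('k::finite \<Rightarrow> real) \<Rightarrow> real^'n^'k \<Rightarrow> real^'n \<Rightarrow> real^'n" where
  "saddle_block a H m d v w = a *\<^sub>R (H *v w - m *\<^sub>R w - (\<Sum>j\<in>UNIV. d j *\<^sub>R (v $ j \<bullet> w) *\<^sub>R v $ j))"

text \<open>In the \<open>x\<close>-equation the gradient factor is zero, so only its own
  derivative, the Hessian, survives. The equation for component \<open>i\<close> contains no
  \<open>v $ j\<close> with \<open>j > i\<close>, which gives the triangular shape.\<close>

lemma saddle_rhs_block_triangular: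
  fixes v :: "real^'n^'k::{finite,linorder}"
  assumes C3: "C_diff 3 E" and grad: "gradient E x = 0"
    and H: "\<And>i. hessian E x *v (v $ i) = m i *\<^sub>R v $ i" and m: "\<And>i. m i \<noteq> 0"
    and orth: "\<And>i j. v $ i \<bullet> v $ j = (if i = j then 1 else 0)"
  obtains L where "(saddle_rhs \<beta> \<gamma> \<eta> E has_derivative L) (at (x, v))"
    "block_triangular L
       (saddle_block (- \<beta>) (hessian E x) 0 (\<lambda>j. (1 + \<eta> / \<bar>m j\<bar>) * m j) v)
       (\<lambda>i. saddle_block (- \<gamma>) (hessian E x) (m i) (\<lambda>j. if j \<le> i then 2 * m j else 0) v)"
proof -
  let ?H = "hessian E x"
  have C2: "C_diff 2 E" using C3 by (rule C_diff_3_imp_2)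
  have symm: "(?H *v u) \<bullet> w = u \<bullet> (?H *v w)" for u w
    using transpose_hessian[OF C2] by (rule symmetric_matrix_inner)
  have fst': "(fst has_derivative fst) (at (x, v))" by (intro derivative_intros)
  have v': "((\<lambda>p. snd p $ i) has_derivative (\<lambda>h. snd h $ i)) (at (x, v))" for i
    by (intro bounded_linear.has_derivative[OF bounded_linear_vec_nth] derivative_intros)
  have g': "((\<lambda>p. gradient E (fst p)) has_derivative (\<lambda>h. ?H *v fst h)) (at (x, v))"
    using has_derivative_compose[OF fst'] gradient_has_derivative[OF C2] by (metis fst_conv)
  \<comment> \<open>The derivative of the Hessian stays abstract: it enters only off-diagonal
    blocks, and for the diagonal ones \<open>T 0 = 0\<close> suffices.\<close>
  obtain T where T: "(hessian E has_derivative T) (at x)"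
    using hessian_differentiable[OF C3] unfolding differentiable_def by blast
  have T0: "T 0 = 0" using linear_0[OF has_derivative_linear[OF T]] .
  have T': "((\<lambda>p. hessian E (fst p)) has_derivative (\<lambda>h. T (fst h))) (at (x, v))"
    using has_derivative_compose[OF fst'] T by (metis fst_conv)
  define W where "W i h = ?H *v snd h $ i + T (fst h) *v v $ i" for i and h :: "(real^'n) \<times> (real^'n^'k::{finite,linorder})"
  have Hv': "((\<lambda>p. hessian E (fst p) *v snd p $ i) has_derivative W i) (at (x, v))" for i
    using bounded_bilinear.FDERIV[OF bounded_bilinear_matrix_vector_mult T' v', of i]
    by (simp add: W_def[abs_def])
  have r': "(\<lambda>p. rayleigh E (fst p) (snd p $ i)) differentiable (at (x, v))" for i
    unfolding rayleigh_def using has_derivative_inner[OF v' Hv'] by (rule differentiableI)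
  have r0: "rayleigh E x (v $ i) = m i" for i by (simp add: rayleigh_def H orth)
  \<comment> \<open>The absolute value is differentiable here because the Rayleigh quotient equals
    \<open>m i\<close>, which is nonzero.\<close>
  have "(\<lambda>p. \<bar>rayleigh E (fst p) (snd p $ i)\<bar>) differentiable (at (x, v))" for i
    using differentiable_compose[of norm "\<lambda>p. rayleigh E (fst p) (snd p $ i)" "(x, v)" UNIV] r' m
    by (simp add: r0 differentiable_norm_at)
  then have "(\<lambda>p. 1 + \<eta> / \<bar>rayleigh E (fst p) (snd p $ i)\<bar>) differentiable (at (x, v))" for i
    using m by (intro differentiable_add differentiable_divide) (auto simp: r0)
  \<comment> \<open>This derivative need not be evaluated: in \<open>gc\<close> it is multiplied by
    an inner product with the vanishing gradient.\<close>
  then have c: "((\<lambda>p. 1 + \<eta> / \<bar>rayleigh E (fst p) (snd p $ i)\<bar>) has_derivative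
      frechet_derivative (\<lambda>p. 1 + \<eta> / \<bar>rayleigh E (fst p) (snd p $ i)\<bar>) (at (x, v))) (at (x, v))" for i
    by (simp only: frechet_derivative_works)
  define L1 where "L1 h = - \<beta> *\<^sub>R (?H *v fst h - (\<Sum>i\<in>UNIV. (1 + \<eta> / \<bar>m i\<bar>) *\<^sub>R ((v $ i \<bullet> (?H *v fst h)) *\<^sub>R v $ i)))"
    for h :: "(real^'n) \<times> (real^'n^'k::{finite,linorder})"
  define L2 where "L2 h i = - \<gamma> *\<^sub>R (W i h
      - ((v $ i \<bullet> W i h + snd h $ i \<bullet> (?H *v v $ i)) *\<^sub>R v $ i + (v $ i \<bullet> (?H *v v $ i)) *\<^sub>R snd h $ i)
      - (\<Sum>j\<in>{..<i}. 2 *\<^sub>R ((v $ j \<bullet> W i h + snd h $ j \<bullet> (?H *v v $ i)) *\<^sub>R v $ j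
                              + (v $ j \<bullet> (?H *v v $ i)) *\<^sub>R snd h $ j)))"
    for h :: "(real^'n) \<times> (real^'n^'k::{finite,linorder})" and i
  have sc: "((\<lambda>p. (snd p $ j \<bullet> (hessian E (fst p) *v snd p $ i)) *\<^sub>R snd p $ j) has_derivative
      (\<lambda>h. (v $ j \<bullet> W i h + snd h $ j \<bullet> (?H *v v $ i)) *\<^sub>R v $ j + (v $ j \<bullet> (?H *v v $ i)) *\<^sub>R snd h $ j)) (at (x, v))"
    for i j
    using has_derivative_scaleR[OF has_derivative_inner[OF v' Hv'] v'] by (simp add: add.commute)
  have gc: "((\<lambda>p. (1 + \<eta> / \<bar>rayleigh E (fst p) (snd p $ i)\<bar>) *\<^sub>R ((snd p $ i \<bullet> gradient E (fst p)) *\<^sub>R snd p $ i))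
      has_derivative (\<lambda>h. (1 + \<eta> / \<bar>m i\<bar>) *\<^sub>R ((v $ i \<bullet> (?H *v fst h)) *\<^sub>R v $ i))) (at (x, v))" for i
    using has_derivative_scaleR[OF c has_derivative_scaleR[OF has_derivative_inner[OF v' g'] v']]
    by (simp add: grad r0)
  have "(saddle_rhs \<beta> \<gamma> \<eta> E has_derivative (\<lambda>h. (L1 h, \<chi> i. L2 h i))) (at (x, v))"
    unfolding saddle_rhs_eq L1_def L2_def
    by (intro has_derivative_Pair has_derivative_vec_lambda has_derivative_scaleR_right
        has_derivative_diff has_derivative_sum gc sc Hv' g')
  moreover have "block_triangular (\<lambda>h. (L1 h, \<chi> i. L2 h i))
       (saddle_block (- \<beta>) ?H 0 (\<lambda>j. (1 + \<eta> / \<bar>m j\<bar>) * m j) v)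
       (\<lambda>i. saddle_block (- \<gamma>) ?H (m i) (\<lambda>j. if j \<le> i then 2 * m j else 0) v)"
    unfolding block_triangular_def
  proof (intro conjI allI impI)
    fix h :: "real^'n" and k :: "real^'n^'k::{finite,linorder}"
    have "v $ i \<bullet> (?H *v w) = m i * (v $ i \<bullet> w)" for i w
      by (simp add: H flip: symm)
    then show "fst (L1 (h, k), \<chi> i. L2 (h, k) i) = saddle_block (- \<beta>) ?H 0 (\<lambda>j. (1 + \<eta> / \<bar>m j\<bar>) * m j) v h"
      by (simp add: L1_def saddle_block_def mult.assoc)
  next
    fix k :: "real^'n^'k::{finite,linorder}" and i assume k: "\<forall>j<i. k $ j = 0"
    have vH: "v $ j \<bullet> (?H *v w) = m j * (v $ j \<bullet> w)" for j w
      by (simp add: H flip: symm)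
    have W0: "W i (0, k) = ?H *v k $ i" by (simp add: W_def T0)
    have "(\<Sum>j\<in>UNIV. (if j \<le> i then 2 * m j else 0) *\<^sub>R (v $ j \<bullet> k $ i) *\<^sub>R v $ j)
      = (\<Sum>j\<in>{..i}. (2 * m j) *\<^sub>R (v $ j \<bullet> k $ i) *\<^sub>R v $ j)"
      by (rule sum.mono_neutral_cong_right) auto
    also have "{..i} = insert i {..<i}" by auto
    \<comment> \<open>The weight at \<open>j = i\<close> is also \<open>2 * m i\<close>:
      differentiating either factor \<open>v $ i\<close> of the Rayleigh quotient contributes one
      \<open>m i\<close>. For \<open>j < i\<close> the 2 is the explicit coefficient of the
      system.\<close>
    finally have split: "(\<Sum>j\<in>UNIV. (if j \<le> i then 2 * m j else 0) *\<^sub>R (v $ j \<bullet> k $ i) *\<^sub>R v $ j)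
      = (2 * m i) *\<^sub>R (v $ i \<bullet> k $ i) *\<^sub>R v $ i + (\<Sum>j\<in>{..<i}. (2 * m j) *\<^sub>R (v $ j \<bullet> k $ i) *\<^sub>R v $ j)"
      by simp
    have "(\<Sum>j\<in>{..<i}. 2 *\<^sub>R ((v $ j \<bullet> W i (0, k) + k $ j \<bullet> (?H *v v $ i)) *\<^sub>R v $ j
                              + (v $ j \<bullet> (?H *v v $ i)) *\<^sub>R k $ j))
       = (\<Sum>j\<in>{..<i}. (2 * m j) *\<^sub>R (v $ j \<bullet> k $ i) *\<^sub>R v $ j)"
      using k by (intro sum.cong) (auto simp: W0 vH orth)
    then show "snd (L1 (0, k), \<chi> i. L2 (0, k) i) $ i
       = saddle_block (- \<gamma>) ?H (m i) (\<lambda>j. if j \<le> i then 2 * m j else 0) v (k $ i)"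
      unfolding saddle_block_def split
      by (simp add: L2_def W0 vH) (simp add: H orth inner_commute algebra_simps)
  qed
  ultimately show ?thesis using that by blast
qed

lemma saddle_block_symmetric:
  assumes "transpose H = H"
  shows "z \<bullet> saddle_block a H c d v w = saddle_block a H c d v z \<bullet> w"
proof -
  have "z \<bullet> (H *v w) = (H *v z) \<bullet> w"
    by (rule symmetric_matrix_inner[OF assms, symmetric])
  then show ?thesis
    by (simp add: saddle_block_def inner_diff_left inner_diff_right inner_sum_left inner_sum_right
        inner_commute mult_ac)
qed

lemma linear_saddle_block: "linear (saddle_block a H c d v)"
  unfolding linear_conv_bounded_linear saddle_block_def[abs_def]
  by (intro bounded_linear_intros matrix_vector_mul_bounded_linear)

lemma saddle_block_eigenvector:
  assumes "H *v (v $ i) = \<mu> *\<^sub>R v $ i" "\<And>i j. v $ i \<bullet> v $ j = (if i = j then 1 else 0)"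
  shows "saddle_block a H c d v (v $ i) = (a * (\<mu> - c - d i)) *\<^sub>R v $ i"
proof -
  have "(\<Sum>j\<in>UNIV. d j *\<^sub>R (v $ j \<bullet> v $ i) *\<^sub>R v $ j) = d i *\<^sub>R v $ i"
    by (simp add: assms(2) if_distrib[of "\<lambda>r. r *\<^sub>R _"] if_distrib[of "\<lambda>r. _ *\<^sub>R r"] cong: if_cong)
  then show ?thesis
    by (simp add: saddle_block_def assms(1) algebra_simps)
qed

lemma saddle_block_eigenvector_orthogonal:
  assumes "H *v b = \<mu> *\<^sub>R b" "\<And>j. v $ j \<bullet> b = 0"
  shows "saddle_block a H c d v b = (a * (\<mu> - c)) *\<^sub>R b"
  by (simp add: saddle_block_def assms algebra_simps)

section \<open>Equilibria of the saddle dynamics\<close>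

text \<open>Induction on the index, with the overlaps \<open>c j\<close> of \<open>v $ i\<close>
  with earlier vectors. Pairing the equilibrium equation with \<open>v $ j\<close> gives \<alpha>_j
  c_j = - \<alpha>_i c_j; pairing it with \<open>v $ i\<close> makes the sum of \<alpha>_j c_j^2
  vanish. Together, \<alpha>_i times the sum of all c_j^2 is zero, so every overlap is zero.\<close>

lemma saddle_rhs_eq_0D:
  fixes v :: "real^'n^'k::{finite,linorder}"
  assumes sym: "transpose (hessian E x) = hessian E x" and norm: "\<And>i. norm (v $ i) = 1"
    and nz: "\<And>i. rayleigh E x (v $ i) \<noteq> 0" and pos: "\<beta> > 0" "\<gamma> > 0" "\<eta> > 0"
    and eq: "saddle_rhs \<beta> \<gamma> \<eta> E (x, v) = 0"
  shows "gradient E x = 0" and "hessian E x *v (v $ i) = rayleigh E x (v $ i) *\<^sub>R v $ i"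
    and "v $ i \<bullet> v $ j = (if i = j then 1 else 0)"
proof -
  let ?H = "hessian E x" and ?\<alpha> = "\<lambda>i. rayleigh E x (v $ i)"
  have symm: "(?H *v u) \<bullet> w = u \<bullet> (?H *v w)" for u w
    using sym by (rule symmetric_matrix_inner)
  have vv: "v $ i \<bullet> v $ i = 1" for i using norm by (simp add: dot_square_norm)
  have Hv: "?H *v v $ i = ?\<alpha> i *\<^sub>R v $ i + (\<Sum>j\<in>{..<i}. 2 *\<^sub>R ((v $ j \<bullet> (?H *v v $ i)) *\<^sub>R v $ j))" for i
  proof -
    have "?H *v v $ i - ?\<alpha> i *\<^sub>R v $ i - (\<Sum>j\<in>{..<i}. 2 *\<^sub>R ((v $ j \<bullet> (?H *v v $ i)) *\<^sub>R v $ j)) = 0"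
      using arg_cong[OF eq, of "\<lambda>p. snd p $ i"] pos by (simp add: saddle_rhs_eq rayleigh_def)
    then show ?thesis by (simp add: algebra_simps)
  qed
  have main: "?H *v v $ i = ?\<alpha> i *\<^sub>R v $ i \<and> (\<forall>j<i. v $ j \<bullet> v $ i = 0)" for i
  proof (induction "pos i" arbitrary: i rule: less_induct)
    case less
    have IH: "?H *v v $ j = ?\<alpha> j *\<^sub>R v $ j \<and> (\<forall>l<j. v $ l \<bullet> v $ j = 0)" if "j < i" for j
      using less that strict_monoD[OF strict_mono_pos that] by blast
    have orth: "v $ j \<bullet> v $ l = (if j = l then 1 else 0)" if "j < i" "l < i" for j l
      using IH[OF that(1)] IH[OF that(2)] vv by (cases j l rule: linorder_cases) (auto simp: inner_commute)
    define c where "c j = v $ j \<bullet> v $ i" for j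
    have vH: "v $ j \<bullet> (?H *v v $ i) = ?\<alpha> j * c j" if "j < i" for j
      using IH[OF that] by (simp add: c_def flip: symm)
    have Hi: "?H *v v $ i = ?\<alpha> i *\<^sub>R v $ i + (\<Sum>j\<in>{..<i}. (2 * ?\<alpha> j * c j) *\<^sub>R v $ j)"
      by (subst Hv) (simp add: vH mult.assoc)
    have c: "?\<alpha> j * c j = - ?\<alpha> i * c j" if "j < i" for j
    proof -
      have "?\<alpha> j * c j = v $ j \<bullet> (?H *v v $ i)" using vH that by simp
      also have "\<dots> = ?\<alpha> i * c j + (\<Sum>l\<in>{..<i}. 2 * ?\<alpha> l * c l * (if j = l then 1 else 0))"
        unfolding Hi using orth that by (auto simp: inner_add_right inner_sum_right c_def intro!: sum.cong)
      also have "(\<Sum>l\<in>{..<i}. 2 * ?\<alpha> l * c l * (if j = l then 1 else 0)) = 2 * ?\<alpha> j * c j"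
        using that by (simp add: if_distrib cong: if_cong)
      finally show ?thesis by linarith
    qed
    have "?\<alpha> i = v $ i \<bullet> (?H *v v $ i)" by (simp add: rayleigh_def)
    also have "\<dots> = ?\<alpha> i + (\<Sum>j\<in>{..<i}. 2 * ?\<alpha> j * c j * c j)"
      unfolding Hi by (simp add: inner_add_right inner_sum_right vv c_def inner_commute)
    also have "(\<Sum>j\<in>{..<i}. 2 * ?\<alpha> j * c j * c j) = (\<Sum>j\<in>{..<i}. - 2 * ?\<alpha> i * (c j)\<^sup>2)"
    proof (intro sum.cong refl)
      fix j assume "j \<in> {..<i}"
      then have "2 * (?\<alpha> j * c j) * c j = 2 * (- ?\<alpha> i * c j) * c j" using c[of j] by simp
      then show "2 * ?\<alpha> j * c j * c j = - 2 * ?\<alpha> i * (c j)\<^sup>2"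
        unfolding power2_eq_square by argo
    qed
    also have "\<dots> = - 2 * ?\<alpha> i * (\<Sum>j\<in>{..<i}. (c j)\<^sup>2)"
      by (simp add: sum_distrib_left)
    finally have "(\<Sum>j\<in>{..<i}. (c j)\<^sup>2) = 0" using nz by simp
    then have "\<forall>j\<in>{..<i}. (c j)\<^sup>2 = 0"
      by (subst (asm) sum_nonneg_eq_0_iff) auto
    then have "c j = 0" if "j < i" for j using that by simp
    then show ?case using Hi by (simp add: c_def)
  qed
  then show "?H *v (v $ i) = ?\<alpha> i *\<^sub>R v $ i" by blast
  show orth: "v $ i \<bullet> v $ j = (if i = j then 1 else 0)" for i j
    using main vv by (metis inner_commute linorder_neqE)
  let ?g = "gradient E x"
  have g: "?g = (\<Sum>i\<in>UNIV. (1 + \<eta> / \<bar>?\<alpha> i\<bar>) *\<^sub>R ((v $ i \<bullet> ?g) *\<^sub>R v $ i))"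
    using arg_cong[OF eq, of fst] pos by (simp add: saddle_rhs_eq)
  \<comment> \<open>The equilibrium equation scales this component of the gradient by a factor
    strictly larger than 1 and returns the same component.\<close>
  have "v $ j \<bullet> ?g = 0" for j
  proof -
    have "v $ j \<bullet> ?g = (\<Sum>i\<in>UNIV. (1 + \<eta> / \<bar>?\<alpha> i\<bar>) * ((v $ i \<bullet> ?g) * (v $ j \<bullet> v $ i)))"
      by (subst g) (simp add: inner_sum_right mult.assoc)
    also have "\<dots> = (1 + \<eta> / \<bar>?\<alpha> j\<bar>) * (v $ j \<bullet> ?g)"
      by (simp add: orth if_distrib cong: if_cong)
    finally have "\<eta> / \<bar>?\<alpha> j\<bar> * (v $ j \<bullet> ?g) = 0" by (simp add: algebra_simps)
    then show ?thesis using pos nz by simp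
  qed
  then show "?g = 0" by (subst g) simp
qed

lemma saddle_rhs_eq_0I:
  fixes v :: "real^'n^'k::{finite,linorder}"
  assumes "gradient E x = 0" "\<And>i. hessian E x *v (v $ i) = m i *\<^sub>R v $ i"
    and "\<And>i j. v $ i \<bullet> v $ j = (if i = j then 1 else 0)"
  shows "saddle_rhs \<beta> \<gamma> \<eta> E (x, v) = 0"
proof -
  have "(\<Sum>j\<in>{..<i}. 2 *\<^sub>R ((v $ j \<bullet> (hessian E x *v v $ i)) *\<^sub>R v $ j)) = 0" for i
    by (intro sum.neutral) (auto simp: assms)
  then show ?thesis by (simp add: saddle_rhs_eq assms zero_prod_def vec_eq_iff)
qed

text \<open>Extending the \<open>v $ i\<close> to an orthonormal eigenbasis separates their
  eigenvalues from those on the orthogonal complement. Injectivity of \<open>($) v\<close> makes the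
  multiplicities agree.\<close>

lemma spectrum_orthonormal_eigenvectors:
  fixes H :: "real^'n^'n" and v :: "real^'n^'k"
  assumes sym: "transpose H = H" and eig: "\<And>i. H *v (v $ i) = m i *\<^sub>R v $ i"
    and orth: "\<And>i j. v $ i \<bullet> v $ j = (if i = j then 1 else 0)"
  obtains B f where "orthonormal B" "card B = CARD('n)" "\<And>b. b \<in> B \<Longrightarrow> H *v b = f b *\<^sub>R b"
    "\<And>b j. b \<in> B - range (($) v) \<Longrightarrow> v $ j \<bullet> b = 0"
    "eigenvalues H = image_mset m (mset_set UNIV) + image_mset f (mset_set (B - range (($) v)))"
proof -
  have inj: "inj (($) v)"
    by (rule injI) (metis orth zero_neq_one)
  have "orthonormal (range (($) v))"
    by (auto simp: orthonormal_def norm_eq_1 orth pairwise_def orthogonal_def)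
  moreover have "\<exists>\<mu>. H *v b = \<mu> *\<^sub>R b" if "b \<in> range (($) v)" for b
    using that eig by auto
  ultimately obtain B where B: "range (($) v) \<subseteq> B" "orthonormal B" "card B = CARD('n)"
    "\<And>b. b \<in> B \<Longrightarrow> \<exists>\<mu>. H *v b = \<mu> *\<^sub>R b"
    using orthonormal_eigenbasis_extend[OF sym, of "range (($) v)"] by blast
  then obtain f where f: "\<And>b. b \<in> B \<Longrightarrow> H *v b = f b *\<^sub>R b" by metis
  have fin: "finite B" using B by (metis card.infinite zero_less_card_finite less_irrefl)
  have fv: "f (v $ i) = m i" for i
  proof -
    have "f (v $ i) *\<^sub>R v $ i = m i *\<^sub>R v $ i" using f[of "v $ i"] B(1) eig[of i] by (metis rangeI subsetD)
    moreover have "v $ i \<noteq> 0" using orth[of i i] by auto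
    ultimately show ?thesis by simp
  qed
  have "mset_set B = mset_set (range (($) v)) + mset_set (B - range (($) v))"
    using B(1) fin by (metis Diff_disjoint Un_Diff_cancel finite_Diff finite_subset mset_set_Union sup.absorb2)
  moreover have "image_mset f (mset_set (range (($) v))) = image_mset m (mset_set UNIV)"
    using inj by (simp add: image_mset_mset_set[symmetric] multiset.map_comp comp_def fv)
  ultimately have "eigenvalues H = image_mset m (mset_set UNIV) + image_mset f (mset_set (B - range (($) v)))"
    using eigenvalues_eigenbasis[OF B(2,3) f] by simp
  moreover have "v $ j \<bullet> b = 0" if "b \<in> B - range (($) v)" for b j
  proof -
    have "v $ j \<in> B" "v $ j \<noteq> b" using B(1) that by auto
    then show ?thesis using B(2) that by (simp add: orthonormal_def pairwise_def orthogonal_def)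
  qed
  ultimately show ?thesis using that[OF B(2,3) f] by blast
qed

text \<open>Monotonicity makes the positions of negative values an initial segment, whose length is
  their number.\<close>

lemma negatives_of_mono_sequence:
  fixes l :: "nat \<Rightarrow> real"
  assumes mono: "\<And>i j. 1 \<le> i \<Longrightarrow> i \<le> j \<Longrightarrow> j \<le> n \<Longrightarrow> l i \<le> l j"
    and "size {#\<mu> \<in># image_mset l (mset_set {1..n}). \<mu> < 0#} = k" and i: "1 \<le> i" "i \<le> n"
  shows "l i < 0 \<longleftrightarrow> i \<le> k"
proof -
  define N where "N = {i \<in> {1..n}. l i < 0}"
  have card: "card N = k"
    using assms(2) by (simp add: N_def filter_mset_image_mset flip: comp_def)
  have "N \<subseteq> {1..k}"
  proof
    fix i assume i: "i \<in> N"
    have "l j < 0" if "1 \<le> j" "j \<le> i" for j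
      using mono[OF that] i by (simp add: N_def)
    then have "{1..i} \<subseteq> N" using i by (auto simp: N_def)
    then have "card {1..i} \<le> k" unfolding card[symmetric] by (intro card_mono) (auto simp: N_def)
    then show "i \<in> {1..k}" using i by (simp add: N_def)
  qed
  then have N: "N = {1..k}" using card by (intro card_subset_eq) auto
  have "l i < 0 \<longleftrightarrow> i \<in> N" using i by (simp add: N_def)
  then show ?thesis using i by (simp add: N)
qed

section \<open>The two implications\<close>

lemma linearly_stable_saddle_rhsD:
  fixes v :: "real^'n^'k::{finite,linorder}"
  assumes C3: "C_diff 3 E" and norm: "\<And>i. norm (v $ i) = 1"
    and pos: "\<beta> > 0" "\<gamma> > 0" "\<eta> > 0"
    and st: "linearly_stable_equilibrium (saddle_domain E) (saddle_rhs \<beta> \<gamma> \<eta> E) (x, v)"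
  obtains m where "gradient E x = 0" "strict_mono m"
    "\<And>i. m i < 0" "\<And>i. hessian E x *v (v $ i) = m i *\<^sub>R v $ i"
    "{#\<mu> \<in># eigenvalues (hessian E x). \<mu> < 0#} = image_mset m (mset_set UNIV)"
proof -
  let ?H = "hessian E x"
  define m where "m i = rayleigh E x (v $ i)" for i
  have C2: "C_diff 2 E" using C3 by (rule C_diff_3_imp_2)
  note sym = transpose_hessian[OF C2, of x]
  have m0: "m i \<noteq> 0" for i
    using st by (simp add: linearly_stable_equilibrium_def saddle_domain_def m_def)
  have eq: "saddle_rhs \<beta> \<gamma> \<eta> E (x, v) = 0"
    using st by (simp add: linearly_stable_equilibrium_def)
  note equilibrium = saddle_rhs_eq_0D[OF sym norm m0[unfolded m_def] pos eq, folded m_def]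
  note grad = equilibrium(1) and Hv = equilibrium(2) and orth = equilibrium(3)
  obtain L where L: "(saddle_rhs \<beta> \<gamma> \<eta> E has_derivative L) (at (x, v))"
    and tri: "block_triangular L
       (saddle_block (- \<beta>) ?H 0 (\<lambda>j. (1 + \<eta> / \<bar>m j\<bar>) * m j) v)
       (\<lambda>i. saddle_block (- \<gamma>) ?H (m i) (\<lambda>j. if j \<le> i then 2 * m j else 0) v)"
    by (rule saddle_rhs_block_triangular[OF C3 grad Hv m0 orth])
  have neg: "\<rho> < 0" if "jacobian_eigenvalue (saddle_rhs \<beta> \<gamma> \<eta> E) (x, v) (of_real \<rho>)" for \<rho>
    using st that unfolding linearly_stable_equilibrium_def by fastforce
  note neg_fst = neg[OF block_triangular_fst_eigenvalue[OF L tri saddle_block_symmetric[OF sym]]]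
  note neg_snd = neg[OF block_triangular_snd_eigenvalue[OF L tri saddle_block_symmetric[OF sym]]]
  have v0: "v $ i \<noteq> 0" for i using norm[of i] by auto
  have m_neg: "m i < 0" for i
  proof -
    \<comment> \<open>The eigenvalue of the \<open>x\<close>-block on \<open>v $ i\<close>, which
      simplifies to \<beta> \<eta> times the sign of \<open>m i\<close>.\<close>
    have "- \<beta> * (m i - 0 - (1 + \<eta> / \<bar>m i\<bar>) * m i) < 0"
      by (rule neg_fst[OF v0]) (rule saddle_block_eigenvector[where d="\<lambda>j. (1 + \<eta> / \<bar>m j\<bar>) * m j", OF Hv orth])
    then have "\<beta> * (\<eta> / \<bar>m i\<bar>) * m i < 0" by (simp add: algebra_simps)
    moreover have "\<beta> * (\<eta> / \<bar>m i\<bar>) > 0" using pos m0 by simp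
    ultimately show ?thesis unfolding mult_less_0_iff[of "\<beta> * (\<eta> / \<bar>m i\<bar>)"] by linarith
  qed
  have mono: "strict_mono m"
  proof (rule strict_monoI)
    fix i j :: 'k assume "i < j"
    \<comment> \<open>For \<open>i < j\<close> the projection term is absent, so stability of the
      \<open>i\<close>-th block in direction \<open>v $ j\<close> is exactly the ordering of the two
      eigenvalues.\<close>
    have "- \<gamma> * (m j - m i - (if j \<le> i then 2 * m j else 0)) < 0"
      by (rule neg_snd[OF v0]) (rule saddle_block_eigenvector[where d="\<lambda>j. if j \<le> i then 2 * m j else 0", OF Hv orth])
    moreover have "\<not> j \<le> i" using \<open>i < j\<close> by simp
    ultimately show "m i < m j" using pos by (simp add: zero_less_mult_iff)
  qed
  obtain B f where B: "orthonormal B" "card B = CARD('n)" "\<And>b. b \<in> B \<Longrightarrow> ?H *v b = f b *\<^sub>R b"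
    "\<And>b j. b \<in> B - range (($) v) \<Longrightarrow> v $ j \<bullet> b = 0"
    and eigs: "eigenvalues ?H = image_mset m (mset_set UNIV) + image_mset f (mset_set (B - range (($) v)))"
    by (rule spectrum_orthonormal_eigenvectors[OF sym Hv orth]) (rule that)
  have fin: "finite B" using B by (metis card.infinite zero_less_card_finite less_irrefl)
  have f_pos: "f b > 0" if b: "b \<in> B - range (($) v)" for b
  proof -
    have "b \<noteq> 0" using b B(1) by (auto simp: orthonormal_def)
    then have "- \<beta> * (f b - 0) < 0"
      by (rule neg_fst) (rule saddle_block_eigenvector_orthogonal, use B b in auto)
    then show ?thesis using pos by (simp add: mult_less_0_iff zero_less_mult_iff)
  qed
  have "{#\<mu> \<in># image_mset m (mset_set UNIV). \<mu> < 0#} = image_mset m (mset_set UNIV)"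
    using m_neg by (simp add: filter_mset_eq_conv)
  moreover have "{#\<mu> \<in># image_mset f (mset_set (B - range (($) v))). \<mu> < 0#} = {#}"
    unfolding set_mset_eq_empty_iff[symmetric] using f_pos fin by (auto dest: less_asym)
  ultimately have "{#\<mu> \<in># eigenvalues ?H. \<mu> < 0#} = image_mset m (mset_set UNIV)"
    by (simp add: eigs)
  then show ?thesis using that grad mono m_neg Hv by blast
qed

lemma linearly_stable_saddle_rhsI:
  fixes v :: "real^'n^'k::{finite,linorder}"
  assumes C3: "C_diff 3 E" and norm: "\<And>i. norm (v $ i) = 1"
    and pos: "\<beta> > 0" "\<gamma> > 0" "\<eta> > 0"
    and grad: "gradient E x = 0" and mono: "strict_mono m" and m_neg: "\<And>i. m i < 0"
    and Hv: "\<And>i. hessian E x *v (v $ i) = m i *\<^sub>R v $ i"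
    and eigs: "eigenvalues (hessian E x) = image_mset m (mset_set UNIV) + M" "\<And>\<mu>. \<mu> \<in># M \<Longrightarrow> \<mu> > 0"
  shows "linearly_stable_equilibrium (saddle_domain E) (saddle_rhs \<beta> \<gamma> \<eta> E) (x, v)"
proof -
  let ?H = "hessian E x"
  have C2: "C_diff 2 E" using C3 by (rule C_diff_3_imp_2)
  note sym = transpose_hessian[OF C2, of x]
  have symm: "(?H *v u) \<bullet> w = u \<bullet> (?H *v w)" for u w
    using sym by (rule symmetric_matrix_inner)
  have m0: "m i \<noteq> 0" for i using m_neg[of i] by simp
  \<comment> \<open>Orthogonality comes from symmetry of the Hessian, because strict monotonicity
    makes the eigenvalues distinct.\<close>
  have orth: "v $ i \<bullet> v $ j = (if i = j then 1 else 0)" for i j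
  proof (cases "i = j")
    case False
    have "m i * (v $ i \<bullet> v $ j) = m j * (v $ i \<bullet> v $ j)"
      using symm[of "v $ i" "v $ j"] by (simp add: Hv)
    moreover have "m i \<noteq> m j" using False strict_mono_imp_inj_on[OF mono] by (auto simp: inj_def)
    ultimately show ?thesis using False by simp
  qed (simp add: norm dot_square_norm)
  obtain L where L: "(saddle_rhs \<beta> \<gamma> \<eta> E has_derivative L) (at (x, v))"
    and tri: "block_triangular L
       (saddle_block (- \<beta>) ?H 0 (\<lambda>j. (1 + \<eta> / \<bar>m j\<bar>) * m j) v)
       (\<lambda>i. saddle_block (- \<gamma>) ?H (m i) (\<lambda>j. if j \<le> i then 2 * m j else 0) v)"
    by (rule saddle_rhs_block_triangular[OF C3 grad Hv m0 orth])
  obtain B f where B: "orthonormal B" "card B = CARD('n)" "\<And>b. b \<in> B \<Longrightarrow> ?H *v b = f b *\<^sub>R b"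
    "\<And>b j. b \<in> B - range (($) v) \<Longrightarrow> v $ j \<bullet> b = 0"
    and eigs': "eigenvalues ?H = image_mset m (mset_set UNIV) + image_mset f (mset_set (B - range (($) v)))"
    by (rule spectrum_orthonormal_eigenvectors[OF sym Hv orth]) (rule that)
  have fin: "finite B" using B by (metis card.infinite zero_less_card_finite less_irrefl)
  have f_pos: "f b > 0" if b: "b \<in> B - range (($) v)" for b
  proof -
    \<comment> \<open>Cancelling the common part in the two descriptions of the spectrum identifies
      the values of \<open>f\<close> off the \<open>v $ i\<close> with the positive multiset
      \<open>M\<close>.\<close>
    have "f b \<in># image_mset f (mset_set (B - range (($) v)))" using b fin by auto
    then show ?thesis using eigs eigs' by (metis add_left_cancel)
  qed
  have J0: "z \<bullet> saddle_block (- \<beta>) ?H 0 (\<lambda>j. (1 + \<eta> / \<bar>m j\<bar>) * m j) v z < 0" if "z \<noteq> 0" for z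
  proof (rule orthonormal_eigenbasis_negative_definite[OF linear_saddle_block B(1,2) _ that])
    fix b assume b: "b \<in> B"
    show "\<exists>\<rho><0. saddle_block (- \<beta>) ?H 0 (\<lambda>j. (1 + \<eta> / \<bar>m j\<bar>) * m j) v b = \<rho> *\<^sub>R b"
    proof (cases "b \<in> range (($) v)")
      case True
      then obtain i where i: "b = v $ i" by blast
      have "\<eta> / \<bar>m i\<bar> * m i < 0" using pos m_neg[of i] by (simp add: mult_pos_neg)
      then have "\<beta> * (\<eta> / \<bar>m i\<bar> * m i) < 0" by (rule mult_pos_neg[OF pos(1)])
      then have "- \<beta> * (m i - 0 - (1 + \<eta> / \<bar>m i\<bar>) * m i) < 0"
        by (simp add: algebra_simps)
      then show ?thesis unfolding i
        using saddle_block_eigenvector[where d="\<lambda>j. (1 + \<eta> / \<bar>m j\<bar>) * m j", OF Hv orth] by blast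
    next
      case False
      then have "- \<beta> * (f b - 0) < 0" using pos f_pos[of b] b by simp
      then show ?thesis
        using saddle_block_eigenvector_orthogonal[OF B(3) B(4)] b False by blast
    qed
  qed
  have J: "z \<bullet> saddle_block (- \<gamma>) ?H (m i) (\<lambda>j. if j \<le> i then 2 * m j else 0) v z < 0" if "z \<noteq> 0" for z i
  proof (rule orthonormal_eigenbasis_negative_definite[OF linear_saddle_block B(1,2) _ that])
    fix b assume b: "b \<in> B"
    show "\<exists>\<rho><0. saddle_block (- \<gamma>) ?H (m i) (\<lambda>j. if j \<le> i then 2 * m j else 0) v b = \<rho> *\<^sub>R b"
    proof (cases "b \<in> range (($) v)")
      case True
      then obtain j where j: "b = v $ j" by blast
      \<comment> \<open>For \<open>j \<le> i\<close> the expression is \<open>- m j - m i\<close>,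
        positive since both are negative; for \<open>j > i\<close> it is positive by strict
        monotonicity.\<close>
      have "m j - m i - (if j \<le> i then 2 * m j else 0) > 0"
        using m_neg[of i] m_neg[of j] strict_monoD[OF mono, of i j] by auto
      then have "- \<gamma> * (m j - m i - (if j \<le> i then 2 * m j else 0)) < 0"
        using pos by (simp only: mult_less_0_iff) simp
      then show ?thesis unfolding j
        using saddle_block_eigenvector[where d="\<lambda>j. if j \<le> i then 2 * m j else 0", OF Hv orth] by blast
    next
      case False
      then have "f b - m i > 0" using f_pos[of b] b m_neg[of i] by simp
      then have "- \<gamma> * (f b - m i) < 0" using pos by simp
      then show ?thesis
        using saddle_block_eigenvector_orthogonal[OF B(3) B(4)] b False by blast
    qed
  qed
  have "(x, v) \<in> saddle_domain E"
    using m0 by (simp add: saddle_domain_def rayleigh_def Hv orth)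
  moreover have "Re \<mu> < 0" if "jacobian_eigenvalue (saddle_rhs \<beta> \<gamma> \<eta> E) (x, v) \<mu>" for \<mu>
    using block_triangular_Re_neg[OF L tri J0 J that] .
  ultimately show ?thesis
    unfolding linearly_stable_equilibrium_def
    using saddle_rhs_eq_0I[OF grad Hv orth] differentiableI[OF L] by blast
qed

theorem theorem3p1:
  fixes E :: "real^'n \<Rightarrow> real"
    and x :: "real^'n"
    and v :: "real^'n^'k::{finite,linorder}"
    and l :: "nat \<Rightarrow> real"
    and \<beta> \<gamma> \<eta> :: real
  assumes "C_diff 3 E"
    and "CARD('k) \<le> CARD('n)"
    and "0 \<notin># eigenvalues (hessian E x)"
    and "eigenvalues (hessian E x) = image_mset l (mset_set {1..CARD('n)})"
    and "\<And>i. 1 \<le> i \<Longrightarrow> i \<le> CARD('k) \<Longrightarrow> i < CARD('n) \<Longrightarrow> l i < l (i + 1)"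
    and "\<And>i. CARD('k) < i \<Longrightarrow> i < CARD('n) \<Longrightarrow> l i \<le> l (i + 1)"
    and "\<And>i. norm (v $ i) = 1"
    and "\<beta> > 0" and "\<gamma> > 0" and "\<eta> > 0"
  shows "linearly_stable_equilibrium (saddle_domain E) (saddle_rhs \<beta> \<gamma> \<eta> E) (x, v)
    \<longleftrightarrow> index_saddle CARD('k) E x \<and> (\<forall>i. eigenvector (hessian E x) (v $ i) (l (pos i)))"
proof -
  let ?H = "hessian E x" and ?k = "CARD('k)" and ?n = "CARD('n)"
  have adjacent: "l i \<le> l (Suc i)" if "1 \<le> i" "i < ?n" for i
    using that assms(5,6)[of i] by (cases "i \<le> ?k") auto
  have mono: "l i \<le> l j" if "1 \<le> i" "i \<le> j" "j \<le> ?n" for i j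
    using that(2,3)
  proof (induction j rule: dec_induct)
    case (step j)
    then show ?case using adjacent[of j] that(1) by simp
  qed simp
  have pos_range: "1 \<le> pos i" "pos i \<le> ?k" for i :: 'k
    using bij_betwE[OF bij_betw_pos[where 'k='k]] by auto
  have lpos: "strict_mono (\<lambda>i :: 'k. l (pos i))"
  proof (rule strict_monoI)
    fix i j :: 'k assume "i < j"
    then have "pos i < pos j" by (rule strict_monoD[OF strict_mono_pos])
    \<comment> \<open>A later position exists, so \<open>pos i\<close> is below the dimension and
      the strict gap hypothesis applies.\<close>
    then have "l (pos i) < l (pos i + 1)" "l (pos i + 1) \<le> l (pos j)"
      using pos_range[of i] pos_range[of j] assms(2) assms(5)[of "pos i"] by (auto intro!: mono)
    then show "l (pos i) < l (pos j)" by simp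
  qed
  have negatives: "l i < 0 \<longleftrightarrow> i \<le> ?k"
    if "size {#\<mu> \<in># eigenvalues ?H. \<mu> < 0#} = ?k" "1 \<le> i" "i \<le> ?n" for i
    by (rule negatives_of_mono_sequence[of ?n l ?k i]) (use mono that assms(4) in simp_all)
  have "mset_set {1..?k} = image_mset pos (mset_set (UNIV :: 'k set))"
    using bij_betw_pos[where 'k='k] by (simp add: bij_betw_def image_mset_mset_set)
  then have l_image: "image_mset (\<lambda>i :: 'k. l (pos i)) (mset_set UNIV) = image_mset l (mset_set {1..?k})"
    by (simp add: multiset.map_comp comp_def)
  show ?thesis
  proof
    assume "linearly_stable_equilibrium (saddle_domain E) (saddle_rhs \<beta> \<gamma> \<eta> E) (x, v)"
    then obtain m where grad: "gradient E x = 0" and m: "strict_mono m" "\<And>i. m i < 0"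
      and Hv: "\<And>i. ?H *v (v $ i) = m i *\<^sub>R v $ i"
      and neg: "{#\<mu> \<in># eigenvalues ?H. \<mu> < 0#} = image_mset m (mset_set UNIV)"
      by (rule linearly_stable_saddle_rhsD[OF assms(1,7-10)]) (rule that)
    have size: "size {#\<mu> \<in># eigenvalues ?H. \<mu> < 0#} = ?k" by (simp add: neg)
    \<comment> \<open>Both \<open>m\<close> and \<open>l\<close> composed with \<open>pos\<close>
      enumerate the negative eigenvalues increasingly, hence they coincide.\<close>
    have "range m = {\<mu>. \<mu> \<in># eigenvalues ?H \<and> \<mu> < 0}"
      using arg_cong[OF neg, of set_mset] by auto
    also have "\<dots> = l ` {1..?k}"
      using negatives[OF size] assms(2) by (auto simp: assms(4) image_iff)
    also have "\<dots> = range (\<lambda>i :: 'k. l (pos i))"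
      using bij_betw_imp_surj_on[OF bij_betw_pos[where 'k='k]] by (metis image_image)
    finally have "m = (\<lambda>i. l (pos i))"
      by (rule strict_mono_range_eq_imp_eq[OF m(1) lpos])
    moreover have "v $ i \<noteq> 0" for i using assms(7)[of i] by auto
    ultimately show "index_saddle ?k E x \<and> (\<forall>i. eigenvector ?H (v $ i) (l (pos i)))"
      using grad size Hv by (simp add: index_saddle_def eigenvector_def)
  next
    assume R: "index_saddle ?k E x \<and> (\<forall>i. eigenvector ?H (v $ i) (l (pos i)))"
    then have size: "size {#\<mu> \<in># eigenvalues ?H. \<mu> < 0#} = ?k" by (simp add: index_saddle_def)
    have "{1..?n} = {1..?k} \<union> {?k+1..?n}" using assms(2) by auto
    then have eigs: "eigenvalues ?H = image_mset (\<lambda>i :: 'k. l (pos i)) (mset_set UNIV) + image_mset l (mset_set {?k+1..?n})"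
      unfolding assms(4) l_image by (simp add: mset_set_Union flip: image_mset_union)
    show "linearly_stable_equilibrium (saddle_domain E) (saddle_rhs \<beta> \<gamma> \<eta> E) (x, v)"
    proof (rule linearly_stable_saddle_rhsI[OF assms(1,7-10) _ lpos _ _ eigs])
      show "gradient E x = 0" using R by (simp add: index_saddle_def)
      show "l (pos i) < 0" for i :: 'k
        using negatives[OF size, of "pos i"] pos_range[of i] assms(2) by simp
      show "?H *v (v $ i) = l (pos i) *\<^sub>R v $ i" for i using R by (simp add: eigenvector_def)
      fix \<mu> assume \<mu>: "\<mu> \<in># image_mset l (mset_set {?k+1..?n})"
      \<comment> \<open>Positions beyond \<open>?k\<close> carry no negative eigenvalue, and
        nondegeneracy excludes zero.\<close>
      then have "\<mu> \<noteq> 0" using assms(3) eigs by auto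
      moreover have "\<mu> \<ge> 0" using \<mu> negatives[OF size] by (force simp: not_less[symmetric])
      ultimately show "\<mu> > 0" by simp
    qed
  qed
qed

end
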